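(* Let $\mathcal V=\{1,\dots,N\}$, and consider an aggregative game with action spaces $U_i=\mathbb R^n$ (so $U=U_1\times\cdots\times U_N=\mathbb R^{Nn}$), local contributions $\phi_i:\mathbb R^n\to\mathbb R^n$ and cost functions $f_i(x_i,\bm x_{-i})=\bar f_i(x_i,\check\sigma(\bm x))$, $i\in\mathcal V$, with pseudo-gradient $F$ and extended pseudo-gradient $\mathbf F$ as defined in the context. Let $\mathcal G_{\sigma(t)}=(\mathcal V,\mathcal E_{\sigma(t)})$ be a switching graph with piecewise constant switching signal $\sigma$ and neighbor sets $\mathcal N_i(t)=\{j\in\mathcal V:(j,i)\in\mathcal E_{\sigma(t)}\}$. Assume: (A1) each $U_i$ is nonempty, closed and convex (automatic here, since $U_i=\mathbb R^n$); for every $i\in\mathcal V$ and every fixed $\bm x_{-i}$, $f_i(x_i,\bm x_{-i})$ is convex and continuously differentiable in $x_i$; and there is $\mu>0$ such that $(\bm x-\bm x')^T(F(\bm x)-F(\bm x'))\ge\mu\|\bm x-\bm x'\|^2$ for all $\bm x,\bm x'\in\mathbb R^{Nn}$; (A2) there is $\theta>0$ such that $\|F(\bm x)-F(\bm x')\|\le\theta\|\bm x-\bm x'\|$ for all $\bm x,\bm x'\in\mathbb R^{Nn}$; (A3) there is $\hat\theta>0$ such that $\|\mathbf F(\bm x,\bm s)-\mathbf F(\bm x,\bm s')\|\le\hat\theta\|\bm s-\bm s'\|$ for all $\bm x,\bm s,\bm s'\in\mathbb R^{Nn}$; and there is $l>0$ such that $\left\|\frac{\partial\phi(\bm x)}{\partial\bm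 x}\right\|\le l$ for all $\bm x\in\mathbb R^{Nn}$; (A4) there is $T>0$ such that the union graph $\mathcal G_{\sigma([t,t+T))}$ is connected (in the sense of the context) for all $t\ge0$; and $\mathcal G_{\sigma(t)}$ is weight-balanced for every $t\ge 0$. Let $\bm x^*$ be the Nash equilibrium of the game (which exists and is unique under (A1)). Then there exists a constant $\delta^*>0$ such that, for any $0<\delta<\delta^*$, any $\alpha,\beta>0$, any $x_i(0)\in\mathbb R^n$, any $s_i(0)\in\mathbb R^n$ $(i\in\mathcal V)$, and any $\nu_i(0)\in\mathbb R^n$ $(i\in\mathcal V)$ with $\sum_{i=1}^N\nu_i(0)=\bm 0$, the solution of the system $$\dot x_i=-\delta J_i(x_i,s_i),$$ $$\dot s_i=-\alpha(s_i-\phi_i(x_i))-\beta\sum_{j\in\mathcal N_i(t)}(s_i-s_j)-\nu_i,$$ $$\dot\nu_i=\alpha\beta\sum_{j\in\mathcal N_i(t)}(s_i-s_j),\qquad i\in\mathcal V,$$ is bounded over $t\ge0$, and $\bm x=\mathrm{col}(x_1,\dots,x_N)$, $\bm s=\mathrm{col}(s_1,\dots,s_N)$, $\bm\nu=\mathrm{col}(\nu_1,\dots,\nu_N)$ satisfy $$\lim_{t\to+\infty}\bm x(t)=\bm x^*,\qquad \lim_{t\to+\infty}\bm s(t)=P_n\phi(\bm x^* ),\qquad \lim_{t\to+\infty}\bm\nu(t)=\alpha P_n^{\perp}\phi(\bm x^* ),$$ all exponentially, where $P_n=\frac{\bm 1_N\bm 1_N^T}{N}\otimes I_n$ and $P_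n^\perp=I_{Nn}-P_n$.
   Context: Norms: $\|\cdot\|$ is the Euclidean norm on vectors and the induced norm on matrices. $\mathrm{col}(a_1,\dots,a_N)$ stacks column vectors; $\bm 1_N\in\mathbb R^N$ is the all-ones vector; $I_p$ is the $p\times p$ identity matrix; $\otimes$ is the Kronecker product. Game. Player $i\in\mathcal V=\{1,\dots,N\}$ has action $x_i\in\mathbb R^n$; $\bm x=\mathrm{col}(x_1,\dots,x_N)\in\mathbb R^{Nn}$; $\bm x_{-i}$ denotes the actions of all players other than $i$. The functions $\phi_i:\mathbb R^n\to\mathbb R^n$ are continuously differentiable, $\phi(\bm x)=\mathrm{col}(\phi_1(x_1),\dots,\phi_N(x_N))$, and the aggregate function is $\check\sigma(\bm x)=\frac1N\sum_{i=1}^N\phi_i(x_i)\in\mathbb R^n$. The cost of player $i$ is $f_i(x_i,\bm x_{-i})=\bar f_i(x_i,\check\sigma(\bm x))$ for some function $\bar f_i$ of two arguments in $\mathbb R^n$. A Nash equilibrium is a vector $\bm x^*=(x_i^*,\bm x_{-i}^* )$ such that $\bar f_i(x_i^*,\check\sigma(x_i^*,\bm x_{-i}^* ))\le \bar f_i(x_i,\check\sigma(x_i,\bm x_{-i}^* ))$ for all $i\in\mathcal V$ and all $x_i\in\mathbb R^n$. Pseudo-gradient: $F(\bm x)=\mathrm{col}(\nabla_1f_1(x_1,\bm x_{-1}),\dots,\nabla_Nf_N(x_N,\bm x_{-N}))$, where $\nabla_if_i$ is the gradient (column vector) of $f_i$ with respect to $x_i$. Extended pseudo-gradient: $\mathbf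 F(\bm x,\bm s)=\mathrm{col}(J_1(x_1,s_1),\dots,J_N(x_N,s_N))$ for $\bm s=\mathrm{col}(s_1,\dots,s_N)\in\mathbb R^{Nn}$, where $$J_i(x_i,s_i)=\nabla_y\bar f_i(y,s_i)|_{y=x_i}+\tfrac1N\nabla\phi_i(x_i)\,\nabla_y\bar f_i(x_i,y)|_{y=s_i},$$ and $\nabla\phi_i(x_i)\in\mathbb R^{n\times n}$ is the transpose of the Jacobian matrix of $\phi_i$ at $x_i$. Graphs. A piecewise constant switching signal is a function $\sigma:[0,\infty)\to\{1,\dots,n_0\}$ ($n_0$ a positive integer) for which there are a sequence $t_0=0,t_1,t_2,\dots$ and a constant $\tau>0$ with $t_{j+1}-t_j\ge\tau$ such that $\sigma$ is constant on each $[t_j,t_{j+1})$. Given directed graphs $\mathcal G_p=(\mathcal V,\mathcal E_p)$, $p=1,\dots,n_0$, without self-loops, the switching graph is $\mathcal G_{\sigma(t)}=(\mathcal V,\mathcal E_{\sigma(t)})$. Its adjacency entries are $a_{ij}(t)=1$ if $(j,i)\in\mathcal E_{\sigma(t)}$ (an edge from $j$ to $i$) and $a_{ij}(t)=0$ otherwise. It is weight-balanced at time $t$ if $\sum_{j\in\mathcal V}a_{ij}(t)=\sum_{j\in\mathcal V}a_{ji}(t)$ for all $i\in\mathcal V$. The union graph $\mathcal G_{\sigma([t,t+T))}$ has node set $\mathcal V$ and edge set $\bigcup_{t'\in[t,t+T)}\mathcal E_{\sigma(t')}$. A directed graph is called connected if there is a node from which every other node can be reached by a directed path. A function $g(t)$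 converges to $g^*$ exponentially if there are $C\ge0$ (possibly depending on the initial condition) and $\lambda>0$ with $\|g(t)-g^*\|\le Ce^{-\lambda t}$ for all $t\ge0$.
   Formalization: The threshold δ* may depend on α and β: a δ* uniform in the gains is false (N=n=1, φ(y)=y, f̄(y,s)=-11y²/2+6sy, α=2δ has the solution x=3e^{δt}, s=2e^{δt}, ν=0). Each f̄_i is taken to be differentiable jointly in its two arguments, so that J_i is defined. *)

theory Defs
  imports "HOL-Analysis.Analysis"
begin

(* The finite type 'v is the set of players (N = CARD('v)) and 'n indexes the coordinates of
   one action.  A stacked vector col(x_1,...,x_N) is an element of real^'n^'v with blocks
   x $ i; its norm and inner product are the Euclidean ones of R^(Nn). *)

section \<open>Aggregative games\<close>

definition grad :: "('a::real_inner \<Rightarrow> real) \<Rightarrow> 'a \<Rightarrow> 'a" where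
  "grad f x = (THE D. GDERIV f x :> D)"

definition upd :: "'a^'v \<Rightarrow> 'v::finite \<Rightarrow> 'a \<Rightarrow> 'a^'v" where
  "upd x i y = (\<chi> j. if j = i then y else x $ j)"

definition stack :: "('v::finite \<Rightarrow> real^'n \<Rightarrow> real^'n) \<Rightarrow> real^'n^'v \<Rightarrow> real^'n^'v" where
  "stack \<phi> x = (\<chi> i. \<phi> i (x $ i))"

definition aggregate :: "('v::finite \<Rightarrow> real^'n \<Rightarrow> real^'n) \<Rightarrow> real^'n^'v \<Rightarrow> real^'n" where
  "aggregate \<phi> x = (1 / real CARD('v)) *\<^sub>R (\<Sum>i\<in>UNIV. \<phi> i (x $ i))"

definition cost ::
  "('v::finite \<Rightarrow> real^'n \<Rightarrow> real^'n) \<Rightarrow> ('v \<Rightarrow> real^'n \<Rightarrow> real^'n \<Rightarrow> real) \<Rightarrow>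
   'v \<Rightarrow> real^'n^'v \<Rightarrow> real" where
  "cost \<phi> fb i x = fb i (x $ i) (aggregate \<phi> x)"

definition nash_equilibrium ::
  "('v::finite \<Rightarrow> real^'n \<Rightarrow> real^'n) \<Rightarrow> ('v \<Rightarrow> real^'n \<Rightarrow> real^'n \<Rightarrow> real) \<Rightarrow>
   real^'n^'v \<Rightarrow> bool" where
  "nash_equilibrium \<phi> fb x \<longleftrightarrow> (\<forall>i y. cost \<phi> fb i x \<le> cost \<phi> fb i (upd x i y))"

definition pseudo_gradient ::
  "('v::finite \<Rightarrow> real^'n \<Rightarrow> real^'n) \<Rightarrow> ('v \<Rightarrow> real^'n \<Rightarrow> real^'n \<Rightarrow> real) \<Rightarrow>
   real^'n^'v \<Rightarrow> real^'n^'v" where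
  "pseudo_gradient \<phi> fb x = (\<chi> i. grad (\<lambda>y. cost \<phi> fb i (upd x i y)) (x $ i))"

definition J ::
  "('v::finite \<Rightarrow> real^'n \<Rightarrow> real^'n) \<Rightarrow> ('v \<Rightarrow> real^'n \<Rightarrow> real^'n \<Rightarrow> real) \<Rightarrow>
   'v \<Rightarrow> real^'n \<Rightarrow> real^'n \<Rightarrow> real^'n" where
  "J \<phi> fb i xi si =
     grad (\<lambda>y. fb i y si) xi
     + (1 / real CARD('v)) *\<^sub>R
         (transpose (jacobian (\<phi> i) (at xi)) *v grad (\<lambda>y. fb i xi y) si)"

definition ext_pseudo_gradient ::
  "('v::finite \<Rightarrow> real^'n \<Rightarrow> real^'n) \<Rightarrow> ('v \<Rightarrow> real^'n \<Rightarrow> real^'n \<Rightarrow> real) \<Rightarrow>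
   real^'n^'v \<Rightarrow> real^'n^'v \<Rightarrow> real^'n^'v" where
  "ext_pseudo_gradient \<phi> fb x s = (\<chi> i. J \<phi> fb i (x $ i) (s $ i))"

definition C1_map :: "(real^'n \<Rightarrow> real^'n) \<Rightarrow> bool" where
  "C1_map g \<longleftrightarrow>
     (\<forall>x. g differentiable (at x)) \<and> continuous_on UNIV (\<lambda>x. jacobian g (at x))"

definition C1_fun :: "(real^'n \<Rightarrow> real) \<Rightarrow> bool" where
  "C1_fun g \<longleftrightarrow> (\<forall>x. g differentiable (at x)) \<and> continuous_on UNIV (grad g)"


section \<open>Switching graphs\<close>

definition switching_signal :: "nat \<Rightarrow> (nat \<Rightarrow> real) \<Rightarrow> (real \<Rightarrow> nat) \<Rightarrow> bool" where
  "switching_signal n0 ts \<sigma> \<longleftrightarrow>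
     (\<forall>t\<ge>0. \<sigma> t \<in> {1..n0}) \<and> ts 0 = 0 \<and>
     (\<exists>\<tau>>0. \<forall>j. ts (Suc j) - ts j \<ge> \<tau>) \<and>
     (\<forall>j. \<forall>t\<in>{ts j..<ts (Suc j)}. \<sigma> t = \<sigma> (ts j))"

definition adj :: "('v \<times> 'v) set \<Rightarrow> 'v \<Rightarrow> 'v \<Rightarrow> real" where
  "adj E i j = (if (j, i) \<in> E then 1 else 0)"

definition neighbors :: "('v \<times> 'v) set \<Rightarrow> 'v \<Rightarrow> 'v set" where
  "neighbors E i = {j. (j, i) \<in> E}"

definition weight_balanced :: "('v::finite \<times> 'v) set \<Rightarrow> bool" where
  "weight_balanced E \<longleftrightarrow> (\<forall>i. (\<Sum>j\<in>UNIV. adj E i j) = (\<Sum>j\<in>UNIV. adj E j i))"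

definition connected_digraph :: "('v \<times> 'v) set \<Rightarrow> bool" where
  "connected_digraph E \<longleftrightarrow> (\<exists>r. \<forall>v. (r, v) \<in> E\<^sup>*)"

definition union_graph :: "(nat \<Rightarrow> ('v \<times> 'v) set) \<Rightarrow> (real \<Rightarrow> nat) \<Rightarrow> real set \<Rightarrow> ('v \<times> 'v) set" where
  "union_graph E \<sigma> I = (\<Union>t\<in>I. E (\<sigma> t))"


section \<open>The closed-loop system\<close>

(* Solutions are continuous and satisfy the differential equations away from the switching
   instants ts j, where the right-hand side may jump. Since ts 0 = 0, the time t = 0 is one of
   the excepted instants, so the two-sided derivative is only used at t > 0.
   No step-size threshold for \<delta> can be uniform in the gains \<alpha>, \<beta>: for one player, n = 1,
   phi(y) = y and fb(y, s) = - 11/2 y^2 + 6 s y one has F(x) = x and J(x, s) = - 5 x + 6 s, and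
   for \<alpha> = 2 \<delta> the system has the solution x = 3 e^(\<delta> t), s = 2 e^(\<delta> t), \<nu> = 0. *)
definition solves_system ::
  "('v::finite \<Rightarrow> real^'n \<Rightarrow> real^'n) \<Rightarrow> ('v \<Rightarrow> real^'n \<Rightarrow> real^'n \<Rightarrow> real) \<Rightarrow>
   (nat \<Rightarrow> ('v \<times> 'v) set) \<Rightarrow> (nat \<Rightarrow> real) \<Rightarrow> (real \<Rightarrow> nat) \<Rightarrow> real \<Rightarrow> real \<Rightarrow> real \<Rightarrow>
   (real \<Rightarrow> real^'n^'v) \<Rightarrow> (real \<Rightarrow> real^'n^'v) \<Rightarrow> (real \<Rightarrow> real^'n^'v) \<Rightarrow> bool" where
  "solves_system \<phi> fb E ts \<sigma> \<delta> \<alpha> \<beta> x s \<nu> \<longleftrightarrow>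
     continuous_on {0..} x \<and> continuous_on {0..} s \<and> continuous_on {0..} \<nu> \<and>
     (\<forall>t\<ge>0. t \<notin> range ts \<longrightarrow> (\<forall>i.
        ((\<lambda>t. x t $ i) has_vector_derivative
           - \<delta> *\<^sub>R J \<phi> fb i (x t $ i) (s t $ i)) (at t) \<and>
        ((\<lambda>t. s t $ i) has_vector_derivative
           - \<alpha> *\<^sub>R (s t $ i - \<phi> i (x t $ i))
           - \<beta> *\<^sub>R (\<Sum>j\<in>neighbors (E (\<sigma> t)) i. s t $ i - s t $ j)
           - \<nu> t $ i) (at t) \<and>
        ((\<lambda>t. \<nu> t $ i) has_vector_derivative
           (\<alpha> * \<beta>) *\<^sub>R (\<Sum>j\<in>neighbors (E (\<sigma> t)) i. s t $ i - s t $ j)) (at t)))"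

(* Block form of the matrix-vector product (A \<otimes> B) x for a stacked vector x. *)
definition kron_mult_vec :: "real^'v^'v \<Rightarrow> real^'n^'n \<Rightarrow> real^'n^'v \<Rightarrow> real^'n^'v::finite" where
  "kron_mult_vec A B x = (\<chi> i. \<Sum>j\<in>UNIV. (A $ i $ j) *\<^sub>R (B *v (x $ j)))"

definition P_avg :: "real^'n^'v \<Rightarrow> real^'n^'v::finite" where
  "P_avg x = kron_mult_vec (\<chi> i j. 1 / real CARD('v)) (mat 1) x"

definition P_perp :: "real^'n^'v \<Rightarrow> real^'n^'v::finite" where
  "P_perp x = x - P_avg x"

(* The rate is an explicit argument: only the constant C may depend on the initial condition. *)
definition exp_converges :: "real \<Rightarrow> (real \<Rightarrow> 'a::real_normed_vector) \<Rightarrow> 'a \<Rightarrow> bool" where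
  "exp_converges r g l \<longleftrightarrow> (\<exists>C\<ge>0. \<forall>t\<ge>0. norm (g t - l) \<le> C * exp (- r * t))"

end

theory Submission
  imports Defs
begin

text \<open>
The argument separates the slow motion of the actions from the fast motion of the
estimators by a change of variables that decouples the fast part almost completely.

\<^emph>\<open>Equilibrium.\<close> By convexity in the own action, the Nash equilibria are the zeros of the
pseudo-gradient \<open>F\<close>. As \<open>F\<close> is strongly monotone and Lipschitz, \<open>x \<mapsto> x - \<gamma> F x\<close> is a
contraction for small \<open>\<gamma> > 0\<close>, so there is exactly one zero. By the chain rule, \<open>F x\<close> is
the extended pseudo-gradient at \<open>s = P_avg (stack \<phi> x)\<close>: the players follow \<open>- \<delta> F\<close> up to an
error of size \<open>\<delta> \<parallel>s - P_avg (stack \<phi> x)\<parallel>\<close>.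

\<^emph>\<open>Coordinates.\<close> Put \<open>w = \<alpha> s + \<nu> - \<alpha> \<phi>(x)\<close>. The Laplacian terms of \<open>s'\<close> and \<open>\<nu>'\<close> cancel
in \<open>w'\<close>, which leaves \<open>w' = - \<alpha> w - \<alpha> D\<phi>(x) x'\<close> and \<open>s' = - w - \<beta> L(t) s\<close>. Weight balance
preserves \<open>\<Sum> \<nu>\<^sub>i = 0\<close>, whence \<open>P_avg w = \<alpha> (P_avg s - P_avg \<phi>(x))\<close>: the tracking error
of \<open>s\<close> is controlled by \<open>w\<close> and by the disagreement \<open>P_perp s\<close>. So there are three errors:
\<open>x - x\<^sup>*\<close> contracts at rate \<open>\<delta> \<mu>\<close>, \<open>w\<close> at rate \<open>\<alpha>\<close> up to \<open>O(\<delta>)\<close>, and \<open>P_perp s\<close> is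
the state of a switched consensus system with input \<open>w\<close>.

\<^emph>\<open>Consensus.\<close> For balanced graphs \<open>\<parallel>P_perp s\<parallel>\<^sup>2\<close> dissipates the energy \<open>\<Sum> a\<^sub>i\<^sub>j(t) \<parallel>s\<^sub>i - s\<^sub>j\<parallel>\<^sup>2\<close>
of the current graph, which controls \<open>P_perp s\<close> only after integration over a window in which
the union graph is connected. Subtracting the energy with the window weights
\<open>\<integral>\<^bsub>t\<^esub>\<^bsup>t+T\<^esup> (t + T - u) a\<^sub>i\<^sub>j(u) du\<close> makes this integral appear in the derivative and turns a
multiple of \<open>\<parallel>P_perp s\<parallel>\<^sup>2\<close> into a strict Lyapunov function (\<open>switched_consensus_lyapunov\<close>).

\<^emph>\<open>Conclusion.\<close> The sum of this function, of \<open>k \<parallel>w\<parallel>\<^sup>2\<close> and of \<open>\<parallel>x - x\<^sup>*\<parallel>\<^sup>2\<close> decays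
exponentially once \<open>k\<close> absorbs the input \<open>w\<close> and \<open>\<delta>\<close> is small enough to absorb the
coupling by Young's inequality (\<open>coupled_decay_inequality\<close>). It is continuous and differentiable
between switching times, which suffices for exponential decay.
\<close>

section \<open>Gradients and Nash equilibria\<close>

lemma grad_eqI:
  assumes "GDERIV f x :> D"
  shows "grad f x = D"
  unfolding grad_def
proof (rule the_equality)
  show "GDERIV f x :> D" by (rule assms)
next
  fix D' assume "GDERIV f x :> D'"
  with assms have "(\<lambda>h. h \<bullet> D') = (\<lambda>h. h \<bullet> D)"
    unfolding gderiv_def by (rule has_derivative_unique[symmetric])
  then show "D' = D"
    by (metis inner_commute vector_eq_rdot)
qed

text \<open>The function \<open>grad\<close> is a definite description, so it needs an existing gradient; in a Euclidean space
the Riesz representative of the derivative is one.\<close>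

lemma GDERIV_grad:
  fixes f :: "'a::euclidean_space \<Rightarrow> real"
  assumes "f differentiable (at x)"
  shows "GDERIV f x :> grad f x"
proof -
  obtain f' where f': "(f has_derivative f') (at x)"
    using assms differentiable_def by blast
  then have lin: "linear f'"
    by (rule has_derivative_linear)
  have "f' h = h \<bullet> adjoint f' 1" for h
    using adjoint_works[OF lin, of h 1] by simp
  then have "f' = (\<lambda>h. h \<bullet> adjoint f' 1)"
    by blast
  with f' have "GDERIV f x :> adjoint f' 1"
    unfolding gderiv_def by simp
  then show ?thesis
    using grad_eqI by metis
qed

text \<open>Sufficiency needs only the one-dimensional tangent inequality, applied on the segment from \<open>x\<close> to
the competing point.\<close>

lemma convex_min_iff_gradient_zero:
  fixes f :: "'a::euclidean_space \<Rightarrow> real"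
  assumes conv: "convex_on UNIV f" and diff: "f differentiable (at x)"
  shows "(\<forall>y. f x \<le> f y) \<longleftrightarrow> grad f x = 0"
proof
  assume "\<forall>y. f x \<le> f y"
  then have "(\<lambda>h. h \<bullet> grad f x) = (\<lambda>h. 0)"
    using differential_zero_maxmin[of x UNIV f] GDERIV_grad[OF diff]
    unfolding gderiv_def by auto
  then show "grad f x = 0"
    by (metis inner_eq_zero_iff)
next
  assume zero: "grad f x = 0"
  show "\<forall>y. f x \<le> f y"
  proof
    fix y
    define g where "g = (\<lambda>t::real. f (x + t *\<^sub>R (y - x)))"
    have conv_g: "convex_on UNIV g"
    proof (rule convex_onI)
      fix t a b :: real
      assume t: "0 < t" "t < 1"
      have eq: "x + ((1 - t) *\<^sub>R a + t *\<^sub>R b) *\<^sub>R (y - x)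
          = (1 - t) *\<^sub>R (x + a *\<^sub>R (y - x)) + t *\<^sub>R (x + b *\<^sub>R (y - x))"
        by (simp add: algebra_simps)
      show "g ((1 - t) *\<^sub>R a + t *\<^sub>R b) \<le> (1 - t) * g a + t * g b"
        unfolding g_def eq using t by (intro convex_onD[OF conv]) auto
    qed simp
    have "((\<lambda>t. x + t *\<^sub>R (y - x)) has_derivative (\<lambda>h. h *\<^sub>R (y - x))) (at 0)"
      by (auto intro!: derivative_eq_intros)
    moreover have "(f has_derivative (\<lambda>h. h \<bullet> 0)) (at (x + 0 *\<^sub>R (y - x)))"
      using GDERIV_grad[OF diff] zero unfolding gderiv_def by simp
    ultimately have "(g has_derivative (\<lambda>h. 0)) (at 0)"
      unfolding g_def using has_derivative_compose by fastforce
    moreover have "(*) (0::real) = (\<lambda>h. 0)"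
      by auto
    ultimately have "(g has_field_derivative 0) (at 0 within UNIV)"
      by (simp add: has_field_derivative_def)
    then have "g 1 - g 0 \<ge> 0 * (1 - 0)"
      by (intro convex_on_imp_above_tangent[OF conv_g]) auto
    then show "f x \<le> f y"
      by (simp add: g_def)
  qed
qed

lemma upd_same [simp]: "upd x i (x $ i) = x"
  by (simp add: upd_def vec_eq_iff)

lemma nash_equilibrium_iff_zero:
  fixes \<phi> :: "'v::finite \<Rightarrow> real^'n \<Rightarrow> real^'n"
  assumes "\<And>i x. convex_on UNIV (\<lambda>y. cost \<phi> fb i (upd x i y))"
    and "\<And>i x. C1_fun (\<lambda>y. cost \<phi> fb i (upd x i y))"
  shows "nash_equilibrium \<phi> fb x \<longleftrightarrow> pseudo_gradient \<phi> fb x = 0"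
proof -
  have "(\<forall>y. cost \<phi> fb i x \<le> cost \<phi> fb i (upd x i y)) \<longleftrightarrow>
      grad (\<lambda>y. cost \<phi> fb i (upd x i y)) (x $ i) = 0" for i
    using convex_min_iff_gradient_zero[OF assms(1), of i x "x $ i"] assms(2)[of i x]
    by (simp add: C1_fun_def)
  then show ?thesis
    by (simp add: nash_equilibrium_def pseudo_gradient_def vec_eq_iff)
qed

text \<open>The map \<open>G x = x - \<gamma> F x\<close> satisfies
\<open>\<parallel>G x - G y\<parallel>\<^sup>2 \<le> (1 - 2 \<gamma> \<mu> + \<gamma>\<^sup>2 M\<^sup>2) \<parallel>x - y\<parallel>\<^sup>2\<close> for any Lipschitz constant \<open>M\<close> of \<open>F\<close>, and
\<open>\<gamma> = \<mu> / M\<^sup>2\<close> minimises the factor. Its fixed points are the zeros of \<open>F\<close>.\<close>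

lemma strongly_monotone_lipschitz_unique_zero:
  fixes F :: "'a::{real_inner,complete_space} \<Rightarrow> 'a"
  assumes mono: "\<And>x y. (x - y) \<bullet> (F x - F y) \<ge> \<mu> * (norm (x - y))\<^sup>2" and "\<mu> > 0"
    and lip: "\<And>x y. norm (F x - F y) \<le> \<theta> * norm (x - y)" and "\<theta> > 0"
  shows "\<exists>!x. F x = 0"
proof -
  \<comment> \<open>A Lipschitz constant exceeding \<open>\<mu>\<close>, so that the contraction factor below is nonnegative.\<close>
  define M where "M = \<mu> + \<theta>"
  have M: "M > \<mu>" "M > \<theta>" "M > 0"
    using assms by (auto simp: M_def)
  define \<gamma> where "\<gamma> = \<mu> / M\<^sup>2"
  have \<gamma>: "\<gamma> > 0"
    using M \<open>\<mu> > 0\<close> by (simp add: \<gamma>_def)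
  define c where "c = 1 - (\<mu> / M)\<^sup>2"
  have c: "0 \<le> c" "c < 1"
    using M \<open>\<mu> > 0\<close> by (auto simp: c_def power_le_one)
  define G where "G = (\<lambda>x. x - \<gamma> *\<^sub>R F x)"
  have contr: "dist (G x) (G y) \<le> sqrt c * dist x y" for x y
  proof -
    have "(norm (G x - G y))\<^sup>2 = (norm (x - y))\<^sup>2 - 2 * \<gamma> * ((x - y) \<bullet> (F x - F y))
        + \<gamma>\<^sup>2 * (norm (F x - F y))\<^sup>2"
    proof -
      have "G x - G y = (x - y) - \<gamma> *\<^sub>R (F x - F y)"
        by (simp add: G_def algebra_simps)
      then show ?thesis
        by (simp only: power2_norm_eq_inner inner_diff_left inner_diff_right
            inner_scaleR_left inner_scaleR_right inner_commute) (simp add: algebra_simps power2_eq_square inner_commute)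
    qed
    also have "\<dots> \<le> (norm (x - y))\<^sup>2 - 2 * \<gamma> * (\<mu> * (norm (x - y))\<^sup>2) + \<gamma>\<^sup>2 * (M * norm (x - y))\<^sup>2"
    proof -
      have "norm (F x - F y) \<le> M * norm (x - y)"
        using lip[of x y] M by (meson less_imp_le mult_right_mono norm_ge_zero order_trans)
      then show ?thesis
        using mono[of x y] \<gamma> by (intro add_mono diff_mono mult_left_mono power_mono) auto
    qed
    also have "\<dots> = (1 - 2 * \<gamma> * \<mu> + \<gamma>\<^sup>2 * M\<^sup>2) * (norm (x - y))\<^sup>2"
      by (simp add: algebra_simps power_mult_distrib)
    also have "1 - 2 * \<gamma> * \<mu> + \<gamma>\<^sup>2 * M\<^sup>2 = c"
      using M by (simp add: \<gamma>_def c_def field_simps power2_eq_square)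
    finally have "(norm (G x - G y))\<^sup>2 \<le> (sqrt c * norm (x - y))\<^sup>2"
      using c by (simp add: power_mult_distrib)
    then show ?thesis
      unfolding dist_norm by (rule power2_le_imp_le) (use c in simp)
  qed
  have "\<exists>!x. G x = x"
    using c contr by (intro banach_fix_type[where c = "sqrt c"]) auto
  then show ?thesis
    using \<gamma> by (simp add: G_def)
qed

lemma aggregate_upd:
  "aggregate \<phi> (upd x i y) = aggregate \<phi> x + (1 / real CARD('v)) *\<^sub>R (\<phi> i y - \<phi> i (x $ i))"
  for \<phi> :: "'v::finite \<Rightarrow> real^'n \<Rightarrow> real^'n"
proof -
  have "(\<Sum>j\<in>UNIV. \<phi> j (upd x i y $ j)) = (\<Sum>j\<in>UNIV. \<phi> j (x $ j)) + (\<phi> i y - \<phi> i (x $ i))"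
    by (simp add: sum.remove[of UNIV i] upd_def)
  then show ?thesis
    by (simp add: aggregate_def scaleR_add_right)
qed

text \<open>Own action \<open>y\<close> enters the cost directly and through the aggregate, whose derivative in \<open>y\<close> is
\<open>1 / N\<close> times that of \<open>\<phi>\<^sub>i\<close>. The chain rule for the jointly differentiable \<open>fb\<^sub>i\<close> produces exactly the
two terms of \<open>J\<close>, the transpose coming from moving the Jacobian across the inner product.\<close>

lemma pseudo_gradient_eq_ext:
  fixes \<phi> :: "'v::finite \<Rightarrow> real^'n \<Rightarrow> real^'n"
  assumes phi_C1: "\<And>i. C1_map (\<phi> i)"
    and fb_diff: "\<And>i p. (\<lambda>(y, s). fb i y s) differentiable (at p)"
  shows "pseudo_gradient \<phi> fb x = ext_pseudo_gradient \<phi> fb x (\<chi> i. aggregate \<phi> x)"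
proof -
  have "grad (\<lambda>y. cost \<phi> fb i (upd x i y)) (x $ i) = J \<phi> fb i (x $ i) (aggregate \<phi> x)" for i
  proof (rule grad_eqI)
    define N where "N = real CARD('v)"
    define a where "a = aggregate \<phi> x"
    define A where "A = jacobian (\<phi> i) (at (x $ i))"
    define g1 where "g1 = grad (\<lambda>y. fb i y a) (x $ i)"
    define g2 where "g2 = grad (\<lambda>y. fb i (x $ i) y) a"
    obtain f' where f': "((\<lambda>(y, s). fb i y s) has_derivative f') (at (x $ i, a))"
      using fb_diff differentiable_def by blast
    have lin: "linear f'"
      using f' by (rule has_derivative_linear)
    have d1: "((\<lambda>y. fb i y a) has_derivative (\<lambda>h. f' (h, 0))) (at (x $ i))"
    proof -
      have "((\<lambda>y. (y, a)) has_derivative (\<lambda>h. (h, 0))) (at (x $ i))"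
        by (auto intro!: derivative_eq_intros)
      from has_derivative_compose[OF this f'] show ?thesis by simp
    qed
    have d2: "((\<lambda>s. fb i (x $ i) s) has_derivative (\<lambda>h. f' (0, h))) (at a)"
    proof -
      have "((\<lambda>s. (x $ i, s)) has_derivative (\<lambda>h. (0, h))) (at a)"
        by (auto intro!: derivative_eq_intros)
      from has_derivative_compose[OF this f'] show ?thesis by simp
    qed
    have g1: "f' (h, 0) = h \<bullet> g1" for h
      using has_derivative_unique[OF d1 GDERIV_grad[unfolded gderiv_def]] d1
      unfolding g1_def differentiable_def by metis
    have g2: "f' (0, h) = h \<bullet> g2" for h
      using has_derivative_unique[OF d2 GDERIV_grad[unfolded gderiv_def]] d2
      unfolding g2_def differentiable_def by metis
    have phi: "(\<phi> i has_derivative (\<lambda>h. A *v h)) (at (x $ i))"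
      using phi_C1[of i] unfolding C1_map_def A_def jacobian_works[symmetric] by blast
    have "((\<lambda>y. (y, a + (1 / N) *\<^sub>R (\<phi> i y - \<phi> i (x $ i)))) has_derivative
        (\<lambda>h. (h, (1 / N) *\<^sub>R (A *v h)))) (at (x $ i))"
      by (auto intro!: derivative_eq_intros phi)
    from has_derivative_compose[OF this, of "\<lambda>(y, s). fb i y s" f'] f'
    have "((\<lambda>y. fb i y (a + (1 / N) *\<^sub>R (\<phi> i y - \<phi> i (x $ i)))) has_derivative
        (\<lambda>h. f' (h, (1 / N) *\<^sub>R (A *v h)))) (at (x $ i))"
      by simp
    moreover have "f' (h, (1 / N) *\<^sub>R (A *v h)) = h \<bullet> (g1 + (1 / N) *\<^sub>R (transpose A *v g2))" for h
    proof -
      have "f' (h, (1 / N) *\<^sub>R (A *v h)) = f' (h, 0) + f' (0, (1 / N) *\<^sub>R (A *v h))"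
        using linear_add[OF lin, of "(h, 0)" "(0, (1 / N) *\<^sub>R (A *v h))"] by simp
      also have "(A *v h) \<bullet> g2 = h \<bullet> (transpose A *v g2)"
        by (metis dot_lmul_matrix vector_transpose_matrix inner_commute transpose_transpose)
      then have "f' (h, 0) + f' (0, (1 / N) *\<^sub>R (A *v h)) = h \<bullet> (g1 + (1 / N) *\<^sub>R (transpose A *v g2))"
        by (simp add: g1 g2 inner_add_right)
      finally show ?thesis .
    qed
    ultimately show "GDERIV (\<lambda>y. cost \<phi> fb i (upd x i y)) (x $ i) :> J \<phi> fb i (x $ i) (aggregate \<phi> x)"
      unfolding gderiv_def J_def cost_def aggregate_upd
      by (simp add: upd_def N_def a_def A_def g1_def g2_def)
  qed
  then show ?thesis
    by (simp add: pseudo_gradient_def ext_pseudo_gradient_def vec_eq_iff)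
qed

section \<open>Stacked vectors and averaging\<close>

lemma bounded_linear_axis: "bounded_linear (axis i :: 'a::real_normed_vector \<Rightarrow> 'a^'v)"
proof (rule bounded_linear_intro[where K = 1])
  show "axis i (x + y) = axis i x + axis i y" for x y :: 'a
    by (simp add: axis_def vec_eq_iff)
  show "axis i (r *\<^sub>R x) = r *\<^sub>R axis i x" for r and x :: 'a
    by (simp add: axis_def vec_eq_iff)
  show "norm (axis i x) \<le> norm x * 1" for x :: 'a
  proof -
    have "norm (axis i x :: 'a^'v) \<le> (\<Sum>j\<in>UNIV. norm ((axis i x :: 'a^'v) $ j))"
      unfolding norm_vec_def by (rule L2_set_le_sum) simp
    also have "\<dots> = (\<Sum>j\<in>(UNIV::'v set). if j = i then norm x else 0)"
      by (intro sum.cong) (auto simp: axis_def)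
    finally show ?thesis by simp
  qed
qed

lemma vec_eq_sum_axis: "v = (\<Sum>i\<in>UNIV. axis i (v $ i))" for v :: "'a::real_normed_vector^'v"
  by (simp add: vec_eq_iff axis_def)

lemma has_derivative_vecI:
  fixes f :: "'a::real_normed_vector \<Rightarrow> 'b::real_normed_vector^'v"
  assumes "\<And>i. ((\<lambda>t. f t $ i) has_derivative (\<lambda>h. f' h $ i)) F"
  shows "(f has_derivative f') F"
proof -
  have "((\<lambda>t. \<Sum>i\<in>UNIV. axis i (f t $ i)) has_derivative (\<lambda>h. \<Sum>i\<in>UNIV. axis i (f' h $ i))) F"
    by (intro has_derivative_sum bounded_linear.has_derivative[OF bounded_linear_axis] assms)
  then show ?thesis
    by (simp add: vec_eq_sum_axis[symmetric])
qed

lemma has_vector_derivative_vecI: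
  fixes f :: "real \<Rightarrow> 'b::real_normed_vector^'v"
  assumes "\<And>i. ((\<lambda>t. f t $ i) has_vector_derivative f' $ i) F"
  shows "(f has_vector_derivative f') F"
  using assms unfolding has_vector_derivative_def by (intro has_derivative_vecI) simp

lemma stack_has_derivative:
  assumes "\<And>i. C1_map (\<phi> i)"
  shows "(stack \<phi> has_derivative frechet_derivative (stack \<phi>) (at x)) (at x)"
proof -
  have "(stack \<phi> has_derivative (\<lambda>h. \<chi> i. jacobian (\<phi> i) (at (x $ i)) *v (h $ i))) (at x)"
  proof (rule has_derivative_vecI)
    fix i
    have "(\<phi> i has_derivative (\<lambda>h. jacobian (\<phi> i) (at (x $ i)) *v h)) (at (x $ i))"
      using assms[of i] unfolding C1_map_def jacobian_works[symmetric] by blast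
    moreover have "((\<lambda>y. y $ i) has_derivative (\<lambda>h. h $ i)) (at x)"
      by (rule bounded_linear_imp_has_derivative[OF bounded_linear_vec_nth])
    ultimately have "((\<lambda>y. \<phi> i (y $ i)) has_derivative
        (\<lambda>h. jacobian (\<phi> i) (at (x $ i)) *v (h $ i))) (at x)"
      by (rule has_derivative_compose[rotated])
    then show "((\<lambda>y. stack \<phi> y $ i) has_derivative
        (\<lambda>h. (\<chi> i. jacobian (\<phi> i) (at (x $ i)) *v (h $ i)) $ i)) (at x)"
      by (simp add: stack_def)
  qed
  then show ?thesis
    using differentiableI frechet_derivative_works by blast
qed

lemma P_avg_nth: "P_avg x $ i = (1 / real CARD('v)) *\<^sub>R (\<Sum>j\<in>UNIV. x $ j)"
  for x :: "real^'n^'v::finite"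
  by (simp add: P_avg_def kron_mult_vec_def scaleR_sum_right)

lemma P_avg_stack: "P_avg (stack \<phi> x) = (\<chi> i. aggregate \<phi> x)"
  by (simp add: vec_eq_iff P_avg_nth aggregate_def stack_def)

lemma P_avg_add: "P_avg (x + y) = P_avg x + P_avg y"
  by (simp add: vec_eq_iff P_avg_nth sum.distrib scaleR_add_right)

lemma P_avg_scaleR: "P_avg (c *\<^sub>R x) = c *\<^sub>R P_avg x"
  by (simp add: vec_eq_iff P_avg_nth scaleR_sum_right)

lemma P_avg_diff: "P_avg (x - y) = P_avg x - P_avg y"
  using P_avg_add[of x "- 1 *\<^sub>R y"] P_avg_scaleR[of "- 1" y] by simp

lemma P_avg_inner_perp: "P_avg x \<bullet> P_perp y = 0" for x y :: "real^'n^'v::finite"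
proof -
  have "(\<Sum>i\<in>UNIV. P_perp y $ i) = 0"
    by (simp add: P_perp_def P_avg_nth sum_subtractf sum_constant_scaleR del: sum_constant)
  moreover have "P_avg x \<bullet> P_perp y = ((1 / real CARD('v)) *\<^sub>R (\<Sum>j\<in>UNIV. x $ j)) \<bullet> (\<Sum>i\<in>UNIV. P_perp y $ i)"
    by (simp only: inner_vec_def[of "P_avg x"] P_avg_nth inner_sum_right)
  ultimately show ?thesis by simp
qed

lemma norm_P_avg_perp: "(norm x)\<^sup>2 = (norm (P_avg x))\<^sup>2 + (norm (P_perp x))\<^sup>2"
proof -
  have "x = P_avg x + P_perp x"
    by (simp add: P_perp_def)
  then have "(norm x)\<^sup>2 = (norm (P_avg x + P_perp x))\<^sup>2"
    by (rule arg_cong)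
  also have "\<dots> = (norm (P_avg x))\<^sup>2 + (norm (P_perp x))\<^sup>2"
    by (simp only: power2_norm_eq_inner inner_add_left inner_add_right P_avg_inner_perp
        inner_commute[of "P_perp x" "P_avg x"] add_0_left add_0_right)
  finally show ?thesis .
qed

lemma norm_P_avg_le: "norm (P_avg x) \<le> norm x"
  by (rule power2_le_imp_le) (use norm_P_avg_perp[of x] in auto)

lemma norm_P_perp_le: "norm (P_perp x) \<le> norm x"
  by (rule power2_le_imp_le) (use norm_P_avg_perp[of x] in auto)

lemma bounded_linear_P_avg: "bounded_linear P_avg"
  by (rule bounded_linear_intro[where K = 1]) (simp_all add: P_avg_add P_avg_scaleR norm_P_avg_le)

lemma bounded_linear_P_perp: "bounded_linear P_perp"
  unfolding P_perp_def[abs_def] by (intro bounded_linear_sub bounded_linear_ident bounded_linear_P_avg)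

lemma P_perp_nth_diff: "P_perp x $ i - P_perp x $ j = x $ i - x $ j"
  by (simp add: P_perp_def P_avg_nth)

lemma inner_P_perp: "P_perp x \<bullet> P_perp y = P_perp x \<bullet> y"
proof -
  have "P_perp x \<bullet> P_avg y = 0"
    using P_avg_inner_perp[of y x] by (simp add: inner_commute)
  then show ?thesis
    by (simp add: P_perp_def[of y] inner_diff_right)
qed

section \<open>Laplacians of balanced digraphs\<close>

definition laplacian :: "('v \<Rightarrow> 'v \<Rightarrow> real) \<Rightarrow> real^'n^'v \<Rightarrow> real^'n^'v::finite" where
  "laplacian a s = (\<chi> i. \<Sum>j\<in>UNIV. a i j *\<^sub>R (s $ i - s $ j))"

text \<open>For the weights of a digraph this is its Dirichlet energy. The weights are kept arbitrary because
the Lyapunov function below uses time averages of adjacency weights.\<close>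

definition dirichlet :: "('v \<Rightarrow> 'v \<Rightarrow> real) \<Rightarrow> real^'n^'v::finite \<Rightarrow> real" where
  "dirichlet a s = (\<Sum>i\<in>UNIV. \<Sum>j\<in>UNIV. a i j * (norm (s $ i - s $ j))\<^sup>2)"

lemma laplacian_neighbors:
  "(\<Sum>j\<in>neighbors E i. s $ i - s $ j) = laplacian (adj E) s $ i" for s :: "real^'n^'v::finite"
proof -
  have "laplacian (adj E) s $ i = (\<Sum>j\<in>UNIV. if j \<in> neighbors E i then s $ i - s $ j else 0)"
    unfolding laplacian_def by (auto intro!: sum.cong simp: adj_def neighbors_def)
  then show ?thesis
    by (simp add: sum.If_cases)
qed

lemma dirichlet_nonneg: "(\<And>i j. 0 \<le> a i j) \<Longrightarrow> 0 \<le> dirichlet a s"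
  unfolding dirichlet_def by (intro sum_nonneg mult_nonneg_nonneg) auto

lemma dirichlet_linear:
  "dirichlet (\<lambda>i j. a i j - c * b i j) s = dirichlet a s - c * dirichlet b s"
  unfolding dirichlet_def by (simp add: sum_subtractf sum_distrib_left algebra_simps)

lemma dirichlet_term_le:
  assumes "\<And>i j. 0 \<le> a i j"
  shows "a i j * (norm (s $ i - s $ j))\<^sup>2 \<le> dirichlet a s"
proof -
  have "a i j * (norm (s $ i - s $ j))\<^sup>2 \<le> (\<Sum>j\<in>UNIV. a i j * (norm (s $ i - s $ j))\<^sup>2)"
    using assms by (intro member_le_sum[of j UNIV "\<lambda>j. a i j * (norm (s $ i - s $ j))\<^sup>2"]) auto
  also have "\<dots> \<le> dirichlet a s"
    unfolding dirichlet_def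
    using assms by (intro member_le_sum[of i UNIV "\<lambda>i. \<Sum>j\<in>UNIV. a i j * (norm (s $ i - s $ j))\<^sup>2"])
      (auto intro!: sum_nonneg)
  finally show ?thesis .
qed

text \<open>Each \<open>s\<^sub>i\<close> enters with weight in-degree minus out-degree.\<close>

lemma balanced_sum_laplacian_zero:
  assumes "weight_balanced E"
  shows "(\<Sum>i\<in>UNIV. laplacian (adj E) s $ i) = 0"
proof -
  have "(\<Sum>i\<in>UNIV. laplacian (adj E) s $ i)
      = (\<Sum>i\<in>UNIV. \<Sum>j\<in>UNIV. adj E i j *\<^sub>R s $ i) - (\<Sum>i\<in>UNIV. \<Sum>j\<in>UNIV. adj E i j *\<^sub>R s $ j)"
    by (simp add: laplacian_def scaleR_diff_right sum_subtractf)
  also have "(\<Sum>i\<in>UNIV. \<Sum>j\<in>UNIV. adj E i j *\<^sub>R s $ j) = (\<Sum>j\<in>UNIV. \<Sum>i\<in>UNIV. adj E i j *\<^sub>R s $ j)"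
    by (rule sum.swap)
  also have "\<dots> = (\<Sum>i\<in>UNIV. \<Sum>j\<in>UNIV. adj E i j *\<^sub>R s $ i)"
    using assms by (simp add: weight_balanced_def flip: scaleR_sum_left)
  finally show ?thesis by simp
qed

text \<open>The graph is directed, so the Laplacian is not symmetric. Polarisation gives the energy plus
\<open>\<Sum> a\<^sub>i\<^sub>j (\<parallel>y\<^sub>j\<parallel>\<^sup>2 - \<parallel>y\<^sub>i\<parallel>\<^sup>2)\<close>, which vanishes by weight balance.\<close>

lemma balanced_inner_laplacian:
  assumes "weight_balanced E"
  shows "2 * (P_perp s \<bullet> laplacian (adj E) s) = dirichlet (adj E) s"
proof -
  define y where "y = P_perp s"
  have diff: "s $ i - s $ j = y $ i - y $ j" for i j
    by (simp add: y_def P_perp_nth_diff)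
  have "dirichlet (adj E) s - 2 * (y \<bullet> laplacian (adj E) s)
     = (\<Sum>i\<in>UNIV. \<Sum>j\<in>UNIV. adj E i j * ((norm (y $ j))\<^sup>2 - (norm (y $ i))\<^sup>2))"
  proof -
    have pointwise: "adj E i j * (norm (y $ i - y $ j))\<^sup>2 - 2 * (y $ i \<bullet> (adj E i j *\<^sub>R (y $ i - y $ j)))
        = adj E i j * ((norm (y $ j))\<^sup>2 - (norm (y $ i))\<^sup>2)" for i j
      unfolding power2_norm_eq_inner inner_scaleR_right inner_diff_left inner_diff_right
      by (simp add: inner_commute[of "y $ j" "y $ i"] algebra_simps)
    have "2 * (y \<bullet> laplacian (adj E) s)
        = (\<Sum>i\<in>UNIV. \<Sum>j\<in>UNIV. 2 * (y $ i \<bullet> (adj E i j *\<^sub>R (y $ i - y $ j))))"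
      unfolding inner_vec_def[of y] laplacian_def vec_lambda_beta diff inner_sum_right sum_distrib_left ..
    then show ?thesis
      unfolding dirichlet_def diff by (simp only: pointwise flip: sum_subtractf)
  qed
  also have "\<dots> = (\<Sum>i\<in>UNIV. \<Sum>j\<in>UNIV. adj E i j * (norm (y $ j))\<^sup>2)
      - (\<Sum>i\<in>UNIV. \<Sum>j\<in>UNIV. adj E i j * (norm (y $ i))\<^sup>2)"
    by (simp add: right_diff_distrib sum_subtractf)
  also have "(\<Sum>i\<in>UNIV. \<Sum>j\<in>UNIV. adj E i j * (norm (y $ j))\<^sup>2)
      = (\<Sum>j\<in>UNIV. \<Sum>i\<in>UNIV. adj E i j * (norm (y $ j))\<^sup>2)"
    by (rule sum.swap)
  also have "\<dots> = (\<Sum>i\<in>UNIV. \<Sum>j\<in>UNIV. adj E i j * (norm (y $ i))\<^sup>2)"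
    using assms by (simp add: weight_balanced_def flip: sum_distrib_right)
  finally show ?thesis by (simp add: y_def)
qed

lemma norm_nth_diff_le: "norm (x $ i - x $ j) \<le> 2 * norm x"
  using norm_triangle_ineq4[of "x $ i" "x $ j"] Finite_Cartesian_Product.norm_nth_le[of x i] Finite_Cartesian_Product.norm_nth_le[of x j] by linarith

text \<open>Adjacency weights are \<open>0\<close> or \<open>1\<close>, so each summand of the Laplacian is bounded by the square root of
the energy. This makes the Laplacian small wherever little energy is dissipated.\<close>

lemma norm_laplacian_le:
  "norm (laplacian (adj E) s) \<le> (real CARD('v))\<^sup>2 * sqrt (dirichlet (adj E) s)"
  for s :: "real^'n^'v::finite"
proof -
  have adj_sq: "norm (adj E i j *\<^sub>R (s $ i - s $ j)) \<le> sqrt (dirichlet (adj E) s)" for i j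
    using dirichlet_term_le[of "adj E" i j s]
    by (intro real_le_rsqrt) (auto simp: adj_def dirichlet_nonneg split: if_splits)
  have "norm (laplacian (adj E) s) \<le> (\<Sum>i\<in>UNIV. norm (laplacian (adj E) s $ i))"
    unfolding norm_vec_def by (rule L2_set_le_sum) simp
  also have "\<dots> \<le> (\<Sum>i\<in>(UNIV::'v set). \<Sum>j\<in>(UNIV::'v set). sqrt (dirichlet (adj E) s))"
    unfolding laplacian_def vec_lambda_beta by (intro sum_mono order_trans[OF norm_sum] adj_sq)
  finally show ?thesis
    by (simp add: power2_eq_square)
qed

text \<open>A Poincare inequality. Along a path from the root every step is controlled by the energy of one
edge, and paths of at most \<open>card E \<le> N\<^sup>2\<close> edges reach every node. Summing the \<open>N\<close> squared distances
to the root, of size \<open>(N\<^sup>2)\<^sup>2\<close> each, gives the factor \<open>N\<^sup>5\<close>.\<close>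

lemma connected_dirichlet_ge:
  fixes s :: "real^'n^'v::finite"
  assumes conn: "connected_digraph E" and nonneg: "\<And>i j. 0 \<le> a i j"
    and edge: "\<And>i j. (j, i) \<in> E \<Longrightarrow> \<tau> \<le> a i j" and "\<tau> > 0"
  shows "\<tau> / (real CARD('v) ^ 5) * (norm (P_perp s))\<^sup>2 \<le> dirichlet a s"
proof -
  define N where "N = real CARD('v)"
  have N: "N \<ge> 1" by (simp add: N_def Suc_leI)
  define m where "m = sqrt (dirichlet a s / \<tau>)"
  have D: "0 \<le> dirichlet a s" by (simp add: dirichlet_nonneg nonneg)
  obtain r where r: "\<And>v. (r, v) \<in> E\<^sup>*"
    using conn unfolding connected_digraph_def by blast
  have step: "norm (s $ i - s $ j) \<le> m" if "(j, i) \<in> E" for i j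
  proof -
    have "\<tau> * (norm (s $ i - s $ j))\<^sup>2 \<le> a i j * (norm (s $ i - s $ j))\<^sup>2"
      using edge[OF that] by (rule mult_right_mono) simp
    also have "\<dots> \<le> dirichlet a s"
      by (rule dirichlet_term_le[OF nonneg])
    finally show ?thesis
      unfolding m_def using \<open>\<tau> > 0\<close> by (intro real_le_rsqrt) (simp add: field_simps)
  qed
  have path: "norm (s $ v - s $ r) \<le> real k * m" if "(r, v) \<in> E ^^ k" for k v
    using that
  proof (induction k arbitrary: v)
    case (Suc k)
    then obtain u where "(r, u) \<in> E ^^ k" "(u, v) \<in> E" by auto
    then have "norm (s $ u - s $ r) \<le> real k * m" "norm (s $ v - s $ u) \<le> m"
      using Suc.IH step by auto
    then show ?case
      using norm_triangle_ineq[of "s $ v - s $ u" "s $ u - s $ r"] by (simp add: algebra_simps)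
  qed simp
  have m0: "0 \<le> m" by (simp add: m_def D \<open>\<tau> > 0\<close> less_imp_le)
  have all: "norm (s $ v - s $ r) \<le> N\<^sup>2 * m" for v
  proof -
    have "finite E" by simp
    from r[of v] obtain k where k: "k \<le> card E" "(r, v) \<in> E ^^ k"
      unfolding rtrancl_finite_eq_relpow[OF \<open>finite E\<close>] by blast
    have "card E \<le> card (UNIV :: ('v \<times> 'v) set)"
      by (rule card_mono) auto
    also have "\<dots> = CARD('v) * CARD('v)"
      by (simp flip: UNIV_Times_UNIV add: card_cartesian_product)
    finally have "real k \<le> real (CARD('v) * CARD('v))"
      using k by (intro of_nat_mono) simp
    then have "real k \<le> N\<^sup>2"
      by (simp add: N_def power2_eq_square)
    then show ?thesis
      using path[OF k(2)] m0 by (meson mult_right_mono order_trans)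
  qed
  \<comment> \<open>Subtracting the value at the root from all blocks does not change the disagreement.\<close>
  define z where "z = (\<chi> i. s $ i - s $ r)"
  have "P_perp s = P_perp z"
    by (simp add: vec_eq_iff P_perp_def P_avg_nth z_def sum_subtractf scaleR_diff_right
        sum_constant_scaleR del: sum_constant)
  then have "(norm (P_perp s))\<^sup>2 \<le> (norm z)\<^sup>2"
    by (simp add: norm_P_perp_le)
  also have "\<dots> = (\<Sum>i\<in>UNIV. (norm (s $ i - s $ r))\<^sup>2)"
    by (simp add: norm_vec_def L2_set_def z_def sum_nonneg)
  also have "\<dots> \<le> (\<Sum>i\<in>(UNIV::'v set). (N\<^sup>2 * m)\<^sup>2)"
    by (intro sum_mono power_mono all) auto
  also have "\<dots> = N ^ 5 * (dirichlet a s / \<tau>)"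
  proof -
    have "m\<^sup>2 = dirichlet a s / \<tau>"
      unfolding m_def by (rule real_sqrt_pow2) (use D \<open>\<tau> > 0\<close> in simp)
    moreover have "N * (N\<^sup>2 * m)\<^sup>2 = N ^ 5 * m\<^sup>2"
      by (simp add: power_mult_distrib eval_nat_numeral)
    ultimately show ?thesis
      by (simp add: N_def)
  qed
  finally show ?thesis
    using N \<open>\<tau> > 0\<close> by (simp add: N_def[symmetric] field_simps)
qed

section \<open>Switching times and switched weights\<close>

locale dwell_times =
  fixes ts :: "nat \<Rightarrow> real" and \<tau> :: real
  assumes ts_0: "ts 0 = 0" and dwell_pos: "\<tau> > 0" and dwell: "\<And>j. ts (Suc j) - ts j \<ge> \<tau>"
begin

lemma ts_strict_mono: "strict_mono ts"
  unfolding strict_mono_Suc_iff by (metis add.commute dwell dwell_pos less_diff_eq add_0 order_less_le_trans)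

lemma ts_ge: "real j * \<tau> \<le> ts j"
proof (induction j)
  case (Suc j)
  then show ?case
    using dwell[of j] by (simp add: algebra_simps)
qed (simp add: ts_0)

lemma ts_nonneg: "0 \<le> ts j"
  using ts_ge[of j] dwell_pos by (meson mult_nonneg_nonneg of_nat_0_le_iff order_less_imp_le order_trans)

lemma switching_interval:
  assumes "t \<ge> 0"
  obtains j where "ts j \<le> t" "t < ts (Suc j)"
proof -
  obtain k where "t < real k * \<tau>"
    using reals_Archimedean3[OF dwell_pos] by blast
  then have ex: "\<exists>k. t < ts k"
    using ts_ge[of k] by (intro exI[of _ k]) linarith
  define k where "k = (LEAST k. t < ts k)"
  have k: "t < ts k"
    unfolding k_def using ex by (rule LeastI_ex)
  then obtain j where j: "k = Suc j"
    using assms ts_0 by (cases k) auto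
  have "\<not> t < ts j"
    using not_less_Least[of j "\<lambda>k. t < ts k"] j k_def by simp
  then show thesis
    using that[of j] k j by (simp add: not_less)
qed

lemma between_not_switching:
  assumes "ts j < t" "t < ts (Suc j)"
  shows "t \<notin> range ts"
proof
  assume "t \<in> range ts"
  then obtain k where "t = ts k" by blast
  then have "j < k" "k < Suc j"
    using assms ts_strict_mono by (auto simp: strict_mono_less)
  then show False by simp
qed

text \<open>The function \<open>W t * exp (r * t)\<close> is nonincreasing on each interval between switching times by
the mean value theorem, and continuity glues the intervals together.\<close>

lemma exponential_decay_off_switching:
  fixes W :: "real \<Rightarrow> real"
  assumes cont: "continuous_on {0..} W"
    and deriv: "\<And>t. t > 0 \<Longrightarrow> t \<notin> range ts \<Longrightarrow>
      \<exists>W'. (W has_real_derivative W') (at t) \<and> W' \<le> - r * W t"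
    and "t \<ge> 0"
  shows "W t \<le> W 0 * exp (- r * t)"
proof -
  define V where "V = (\<lambda>t. W t * exp (r * t))"
  have contV: "continuous_on {0..} V"
    unfolding V_def by (intro continuous_intros cont)
  have step: "V b \<le> V (ts j)" if "ts j \<le> b" "b \<le> ts (Suc j)" for b j
  proof (rule DERIV_nonpos_imp_decreasing_open[OF that(1)])
    show "continuous_on {ts j..b} V"
      by (rule continuous_on_subset[OF contV]) (use ts_nonneg[of j] in auto)
    fix u assume u: "ts j < u" "u < b"
    then have "u > 0" "u \<notin> range ts"
      using that ts_nonneg[of j] between_not_switching[of j u] by auto
    then obtain W' where W': "(W has_real_derivative W') (at u)" "W' \<le> - r * W u"
      using deriv by blast
    have "(V has_real_derivative (W' * exp (r * u) + r * exp (r * u) * W u)) (at u)"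
      unfolding V_def by (auto intro!: derivative_eq_intros W'(1))
    moreover have "W' * exp (r * u) + r * exp (r * u) * W u = (W' + r * W u) * exp (r * u)"
      by (simp add: algebra_simps)
    moreover have "(W' + r * W u) * exp (r * u) \<le> 0"
      using W'(2) by (intro mult_nonpos_nonneg) auto
    ultimately show "\<exists>y. (V has_real_derivative y) (at u) \<and> y \<le> 0"
      by auto
  qed
  have init: "V (ts j) \<le> V 0" for j
  proof (induction j)
    case (Suc j)
    then show ?case
      using step[of j "ts (Suc j)"] dwell[of j] dwell_pos by simp
  qed (simp add: ts_0)
  obtain j where "ts j \<le> t" "t < ts (Suc j)"
    using switching_interval[OF \<open>t \<ge> 0\<close>] .
  then have "V t \<le> V 0"
    using step[of j t] init[of j] by simp
  then have "W t * exp (r * t) * exp (- r * t) \<le> W 0 * exp (- r * t)"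
    unfolding V_def by (intro mult_right_mono) auto
  then show ?thesis
    by (simp add: mult.assoc flip: exp_add)
qed

end

text \<open>The function \<open>a\<close> models the time course of a single adjacency entry.\<close>

locale switched_weight = dwell_times +
  fixes a :: "real \<Rightarrow> real"
  assumes piecewise: "\<And>j t. ts j \<le> t \<Longrightarrow> t < ts (Suc j) \<Longrightarrow> a t = a (ts j)"
    and weight_bounds: "\<And>t. t \<ge> 0 \<Longrightarrow> 0 \<le> a t \<and> a t \<le> 1"
begin

definition activity :: "real \<Rightarrow> real" where
  "activity t = integral {0..t} a"

text \<open>For \<open>t \<ge> 0\<close> and \<open>T > 0\<close> this is \<open>\<integral>\<^bsub>t\<^esub>\<^bsup>t+T\<^esup> (t + T - u) a u du\<close>, integrated by parts so that
only the continuous function \<open>activity\<close> is integrated. The lower limit \<open>-1\<close> makes the outer integral differentiable at every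
\<open>t \<ge> 0\<close> in the two-sided sense; on negative times \<open>activity\<close> is zero.\<close>

definition window_weight :: "real \<Rightarrow> real \<Rightarrow> real" where
  "window_weight T t = integral {-1..t + T} activity - integral {-1..t} activity - T * activity t"

lemma has_integral_within_dwell:
  assumes "ts j \<le> p" "p \<le> q" "q \<le> ts (Suc j)"
  shows "(a has_integral (q - p) * a (ts j)) {p..q}"
proof -
  have "((\<lambda>u. a (ts j)) has_integral (q - p) * a (ts j)) {p..q}"
    using has_integral_const_real[of "a (ts j)" p q] assms by simp
  then show ?thesis
    by (rule has_integral_spike_finite[of "{q}", rotated 2]) (use assms piecewise in auto)
qed

lemma integrable_weight: "a integrable_on {0..t}"
proof (cases "t \<ge> 0")
  case True
  have until: "a integrable_on {0..ts j}" for j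
  proof (induction j)
    case 0
    show ?case
      using has_integral_integrable[OF has_integral_within_dwell[of 0 "ts 0" "ts 0"]] dwell[of 0] dwell_pos
      by (simp add: ts_0)
  next
    case (Suc j)
    have le: "ts j \<le> ts (Suc j)" using dwell[of j] dwell_pos by simp
    then have "a integrable_on {ts j..ts (Suc j)}"
      using has_integral_integrable[OF has_integral_within_dwell[OF order_refl _ order_refl]] by blast
    then show ?case
      by (rule Henstock_Kurzweil_Integration.integrable_combine[OF ts_nonneg le Suc])
  qed
  obtain j where "ts j \<le> t" "t < ts (Suc j)"
    using switching_interval[OF True] .
  then show ?thesis
    by (intro integrable_subinterval_real[OF until[of "Suc j"]]) auto
qed (simp add: integrable_on_empty)

lemma activity_diff:
  assumes "0 \<le> s" "s \<le> t"
  shows "activity t - activity s = integral {s..t} a"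
  using Henstock_Kurzweil_Integration.integral_combine[OF assms integrable_weight]
  unfolding activity_def by simp

lemma activity_diff_bounds:
  assumes "0 \<le> s" "s \<le> t"
  shows "0 \<le> activity t - activity s" "activity t - activity s \<le> t - s"
proof -
  have int: "a integrable_on {s..t}"
    using integrable_weight[of t] assms by (rule_tac integrable_subinterval_real) auto
  show "0 \<le> activity t - activity s"
    unfolding activity_diff[OF assms]
    using weight_bounds assms by (intro integral_nonneg[OF int]) auto
  have "integral {s..t} a \<le> integral {s..t} (\<lambda>_. 1)"
    using weight_bounds assms by (intro integral_le[OF int]) auto
  then show "activity t - activity s \<le> t - s"
    unfolding activity_diff[OF assms] using assms by simp
qed

lemma continuous_activity: "continuous_on S activity"
proof -
  \<comment> \<open>For negative \<open>t\<close> the interval of integration is empty.\<close>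
  have neg: "activity t = activity (max 0 t)" for t
    by (cases "t \<ge> 0") (auto simp: activity_def max_def)
  have pos: "\<bar>activity s - activity t\<bar> \<le> \<bar>s - t\<bar>" if "0 \<le> s" "0 \<le> t" for s t
    using activity_diff_bounds[of s t] activity_diff_bounds[of t s] that by (cases "s \<le> t") auto
  have lip: "dist (activity s) (activity t) \<le> 1 * dist s t" for s t
  proof -
    have "\<bar>activity (max 0 s) - activity (max 0 t)\<bar> \<le> \<bar>max 0 s - max 0 t\<bar>"
      by (rule pos) auto
    also have "\<dots> \<le> \<bar>s - t\<bar>"
      by (auto simp: max_def)
    finally show ?thesis
      unfolding neg[symmetric] by (simp add: dist_real_def)
  qed
  then have "1-lipschitz_on S activity"
    by (intro lipschitz_onI) auto
  then show ?thesis
    by (rule lipschitz_on_continuous_on)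
qed

lemma activity_deriv:
  assumes "t > 0" "t \<notin> range ts"
  shows "(activity has_real_derivative a t) (at t)"
proof -
  obtain j where j: "ts j \<le> t" "t < ts (Suc j)"
    using switching_interval[of t] assms by auto
  then have j': "ts j < t"
    using assms by (cases "ts j = t") auto
  have "eventually (\<lambda>u. u \<in> {ts j<..<ts (Suc j)}) (nhds t)"
    using j j' by (intro eventually_nhds_in_open) auto
  then have "eventually (\<lambda>u. a u = a (ts j)) (nhds t)"
    by eventually_elim (use piecewise in auto)
  then have "isCont a t"
    by (subst isCont_cong[where g = "\<lambda>_. a (ts j)"]) auto
  then have "continuous (at t within ({0..t + 1} - {})) a"
    by (rule continuous_at_imp_continuous_within)
  then have "(activity has_vector_derivative a t) (at t within ({0..t + 1} - {}))"
    unfolding activity_def[abs_def] using assms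
    by (intro integral_has_vector_derivative_continuous_at integrable_weight) auto
  moreover have "at t within ({0..t + 1} - {}) = at t"
    by (rule at_within_interior) (use assms in auto)
  ultimately show ?thesis
    by (simp add: has_real_derivative_iff_has_vector_derivative)
qed

lemma activity_integral_deriv:
  assumes "t \<ge> 0"
  shows "((\<lambda>t. integral {-1..t} activity) has_real_derivative activity t) (at t)"
proof -
  have "((\<lambda>t. integral {-1..t} activity) has_real_derivative activity t) (at t within {-1..t + 1})"
    using assms by (intro integral_has_real_derivative continuous_activity) auto
  moreover have "at t within {-1..t + 1} = at t"
    by (rule at_within_interior) (use assms in auto)
  ultimately show ?thesis by simp
qed

lemma window_weight_bounds:
  assumes "t \<ge> 0" "T > 0"
  shows "0 \<le> window_weight T t" "window_weight T t \<le> T\<^sup>2"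
proof -
  have "\<exists>z>t. z < t + T \<and> integral {-1..t + T} activity - integral {-1..t} activity
      = (t + T - t) * activity z"
    using assms by (intro MVT2 activity_integral_deriv) auto
  then obtain z where z: "t < z" "z < t + T"
    and mvt: "integral {-1..t + T} activity - integral {-1..t} activity = T * activity z"
    by auto
  have eq: "window_weight T t = T * (activity z - activity t)"
    unfolding window_weight_def mvt by (simp add: algebra_simps)
  show "0 \<le> window_weight T t"
    unfolding eq using activity_diff_bounds[of t z] assms z by simp
  have "activity z - activity t \<le> T"
    using activity_diff_bounds[of t z] assms z by simp
  then show "window_weight T t \<le> T\<^sup>2"
    unfolding eq power2_eq_square using assms by simp
qed

text \<open>The gain of activity over the window ahead appears with a positive sign; it is the quantity that
connectivity of the union graph bounds from below.\<close>

lemma window_weight_deriv: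
  assumes "t > 0" "t \<notin> range ts" "T > 0"
  shows "(window_weight T has_real_derivative activity (t + T) - activity t - T * a t) (at t)"
proof -
  have "((\<lambda>t. integral {-1..t + T} activity) has_real_derivative activity (t + T)) (at t)"
    using activity_integral_deriv[of "t + T"] assms by (simp add: DERIV_shift)
  moreover have "((\<lambda>t. integral {-1..t} activity) has_real_derivative activity t) (at t)"
    using activity_integral_deriv[of t] assms by simp
  moreover have "((\<lambda>t. T * activity t) has_real_derivative T * a t) (at t)"
    by (rule DERIV_cmult[OF activity_deriv[OF assms(1,2)]])
  ultimately show ?thesis
    unfolding window_weight_def[abs_def] by (intro DERIV_diff)
qed

lemma continuous_window_weight: "T > 0 \<Longrightarrow> continuous_on {0..} (window_weight T)"
proof -
  assume "T > 0"
  have H: "continuous_on {0..} (\<lambda>t. integral {-1..t} activity)"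
    using activity_integral_deriv by (auto intro!: continuous_at_imp_continuous_on DERIV_isCont)
  have "continuous_on {0..} (\<lambda>t. integral {-1..t + T} activity)"
    by (rule continuous_on_compose2[OF H]) (use \<open>T > 0\<close> in \<open>auto intro!: continuous_intros\<close>)
  with H show ?thesis
    unfolding window_weight_def[abs_def] by (intro continuous_intros continuous_activity)
qed

text \<open>An entry that is switched on at some instant stays on for at least the dwell time \<open>\<tau>\<close>, either before or
after that instant. Enlarging the window by \<open>\<tau>\<close> at both ends therefore catches activity of total length
at least \<open>\<tau>\<close>, however short the overlap with the original window is.\<close>

lemma activity_gain:
  assumes "t \<ge> 0" "u \<in> {t + \<tau>..<t + \<tau> + T}" "a u = 1"
  shows "\<tau> \<le> activity (t + (T + 2 * \<tau>)) - activity t"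
proof -
  obtain j where j: "ts j \<le> u" "u < ts (Suc j)"
    using switching_interval[of u] assms dwell_pos by auto
  \<comment> \<open>An interval of length \<open>\<tau>\<close> with \<open>u\<close> in it and inside the dwell interval of \<open>u\<close>.\<close>
  define p where "p = max (ts j) (u - \<tau>)"
  have p: "ts j \<le> p" "p + \<tau> \<le> ts (Suc j)" "t \<le> p" "p + \<tau> \<le> t + (T + 2 * \<tau>)"
    using j dwell[of j] dwell_pos assms by (auto simp: p_def max_def)
  have "a (ts j) = 1"
    using piecewise j assms by metis
  then have "(a has_integral \<tau>) {p..p + \<tau>}"
    using has_integral_within_dwell[of j p "p + \<tau>"] p dwell_pos by simp
  then have "activity (p + \<tau>) - activity p = \<tau>"
    using activity_diff[of p "p + \<tau>"] p assms dwell_pos by (simp add: integral_unique)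
  moreover have "activity t \<le> activity p"
    using activity_diff_bounds[of t p] p assms by simp
  moreover have "activity (p + \<tau>) \<le> activity (t + (T + 2 * \<tau>))"
    using activity_diff_bounds[of "p + \<tau>" "t + (T + 2 * \<tau>)"] p assms dwell_pos by simp
  ultimately show ?thesis by simp
qed

end

section \<open>A Lyapunov function for switched consensus\<close>

lemma has_real_derivative_norm_power2:
  assumes "(f has_vector_derivative f') (at t)"
  shows "((\<lambda>t. (norm (f t))\<^sup>2) has_real_derivative 2 * (f t \<bullet> f')) (at t)"
proof -
  have "((\<lambda>t. f t \<bullet> f t) has_derivative (\<lambda>h. f t \<bullet> (h *\<^sub>R f') + (h *\<^sub>R f') \<bullet> f t)) (at t)"
    using assms unfolding has_vector_derivative_def by (intro has_derivative_inner)
  moreover have "(\<lambda>h. f t \<bullet> (h *\<^sub>R f') + (h *\<^sub>R f') \<bullet> f t) = (*) (2 * (f t \<bullet> f'))"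
    by (auto simp: inner_commute)
  ultimately show ?thesis
    unfolding power2_norm_eq_inner has_field_derivative_def by simp
qed

lemma has_vector_derivative_nth:
  assumes "(f has_vector_derivative f') F"
  shows "((\<lambda>t. f t $ i) has_vector_derivative f' $ i) F"
  using bounded_linear.has_vector_derivative[OF bounded_linear_vec_nth assms] .

lemma dirichlet_has_real_derivative:
  fixes s :: "real \<Rightarrow> real^'n^'v::finite"
  assumes A: "\<And>i j. ((\<lambda>t. A t i j) has_real_derivative A' i j) (at t)"
    and s: "(s has_vector_derivative s') (at t)"
  shows "((\<lambda>t. dirichlet (A t) (s t)) has_real_derivative
    dirichlet A' (s t) + 2 * (\<Sum>i\<in>UNIV. \<Sum>j\<in>UNIV. A t i j * ((s t $ i - s t $ j) \<bullet> (s' $ i - s' $ j)))) (at t)"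
proof -
  have sq: "((\<lambda>t. (norm (s t $ i - s t $ j))\<^sup>2) has_real_derivative
      2 * ((s t $ i - s t $ j) \<bullet> (s' $ i - s' $ j))) (at t)" for i j
    by (intro has_real_derivative_norm_power2 has_vector_derivative_diff has_vector_derivative_nth s)
  have "((\<lambda>t. dirichlet (A t) (s t)) has_real_derivative
      (\<Sum>i\<in>UNIV. \<Sum>j\<in>UNIV. A' i j * (norm (s t $ i - s t $ j))\<^sup>2
        + 2 * ((s t $ i - s t $ j) \<bullet> (s' $ i - s' $ j)) * A t i j)) (at t)"
    unfolding dirichlet_def by (intro DERIV_sum DERIV_mult A sq)
  moreover have "2 * ((s t $ i - s t $ j) \<bullet> (s' $ i - s' $ j)) * A t i j
      = 2 * (A t i j * ((s t $ i - s t $ j) \<bullet> (s' $ i - s' $ j)))" for i j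
    by simp
  ultimately show ?thesis
    by (simp only: dirichlet_def sum.distrib sum_distrib_left)
qed

lemma dirichlet_le:
  fixes s :: "real^'n^'v::finite"
  assumes "\<And>i j. A i j \<le> M" "0 \<le> M"
  shows "dirichlet A s \<le> 4 * M * (real CARD('v))\<^sup>2 * (norm (P_perp s))\<^sup>2"
proof -
  have "A i j * (norm (s $ i - s $ j))\<^sup>2 \<le> M * (2 * norm (P_perp s))\<^sup>2" for i j
    using norm_nth_diff_le[of "P_perp s" i j] assms
    by (intro mult_mono power_mono) (auto simp: P_perp_nth_diff)
  then have "dirichlet A s \<le> (\<Sum>i\<in>(UNIV::'v set). \<Sum>j\<in>(UNIV::'v set). M * (2 * norm (P_perp s))\<^sup>2)"
    unfolding dirichlet_def by (intro sum_mono)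
  then show ?thesis
    by (simp add: power2_eq_square algebra_simps)
qed

lemma dirichlet_bilinear_bound:
  fixes s s' :: "real^'n^'v::finite"
  assumes "\<And>i j. 0 \<le> A i j" "\<And>i j. A i j \<le> M"
  shows "\<bar>\<Sum>i\<in>UNIV. \<Sum>j\<in>UNIV. A i j * ((s $ i - s $ j) \<bullet> (s' $ i - s' $ j))\<bar>
    \<le> 4 * M * (real CARD('v))\<^sup>2 * norm (P_perp s) * norm s'"
proof -
  have "\<bar>A i j * ((s $ i - s $ j) \<bullet> (s' $ i - s' $ j))\<bar> \<le> M * ((2 * norm (P_perp s)) * (2 * norm s'))" for i j
  proof -
    have "\<bar>(s $ i - s $ j) \<bullet> (s' $ i - s' $ j)\<bar> \<le> norm (s $ i - s $ j) * norm (s' $ i - s' $ j)"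
      by (rule Cauchy_Schwarz_ineq2)
    also have "\<dots> \<le> (2 * norm (P_perp s)) * (2 * norm s')"
      using norm_nth_diff_le[of "P_perp s" i j] norm_nth_diff_le[of s' i j]
      by (intro mult_mono) (auto simp: P_perp_nth_diff)
    finally show ?thesis
      unfolding abs_mult using assms[of i j] by (intro mult_mono) auto
  qed
  then have "\<bar>\<Sum>i\<in>UNIV. \<Sum>j\<in>UNIV. A i j * ((s $ i - s $ j) \<bullet> (s' $ i - s' $ j))\<bar>
     \<le> (\<Sum>i\<in>(UNIV::'v set). \<Sum>j\<in>(UNIV::'v set). M * ((2 * norm (P_perp s)) * (2 * norm s')))"
    by (intro order_trans[OF sum_abs] sum_mono)
  then show ?thesis
    by (simp add: power2_eq_square algebra_simps)
qed

lemma young: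
  fixes p u v e :: real
  assumes "e > 0"
  shows "p * (u * v) \<le> e / 4 * u\<^sup>2 + p\<^sup>2 / e * v\<^sup>2"
proof -
  have "0 \<le> (e / 2 * u - p * v)\<^sup>2 / e"
    using assms by simp
  also have "\<dots> = e / 4 * u\<^sup>2 + p\<^sup>2 / e * v\<^sup>2 - p * (u * v)"
    using assms by (simp add: power2_eq_square field_simps)
  finally show ?thesis by simp
qed

text \<open>The function is \<open>U t s = \<kappa> \<parallel>P_perp s\<parallel>\<^sup>2 - \<Sum> A\<^sub>i\<^sub>j(t) \<parallel>s\<^sub>i - s\<^sub>j\<parallel>\<^sup>2\<close> with the window weights \<open>A\<^sub>i\<^sub>j\<close> of
the edges. In its derivative the first summand contributes \<open>- \<kappa> \<beta> q\<close>, with \<open>q\<close> the energy of the current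
graph, and a term of size \<open>2 \<kappa> \<parallel>P_perp s\<parallel> \<parallel>w\<parallel>\<close>. The second contributes minus the energy collected over the
window, which is at most \<open>- c0 \<parallel>P_perp s\<parallel>\<^sup>2\<close>, and terms bounded by multiples of \<open>q\<close> and of
\<open>\<parallel>P_perp s\<parallel> (sqrt q + \<parallel>w\<parallel>)\<close>. A large \<open>\<kappa>\<close> dominates all terms with \<open>q\<close>. The constants do not depend on the
trajectory \<open>s\<close> or on the input \<open>w\<close>, so that the step size can be chosen before the trajectory.\<close>

lemma switched_consensus_lyapunov:
  fixes E :: "nat \<Rightarrow> ('v::finite \<times> 'v) set" and T \<beta> :: real
  assumes signal: "switching_signal n0 ts \<sigma>" and "T > 0" and "\<beta> > 0"
    and conn: "\<And>t. t \<ge> 0 \<Longrightarrow> connected_digraph (union_graph E \<sigma> {t..<t + T})"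
    and bal: "\<And>t. t \<ge> 0 \<Longrightarrow> weight_balanced (E (\<sigma> t))"
  obtains c K \<kappa> :: real and U :: "real \<Rightarrow> real^'n^'v \<Rightarrow> real"
  where "c > 0" "K > 0" "\<kappa> > 0"
    and "\<And>t s. t \<ge> 0 \<Longrightarrow> (norm (P_perp s))\<^sup>2 \<le> U t s \<and> U t s \<le> \<kappa> * (norm (P_perp s))\<^sup>2"
    and "\<And>s. continuous_on {0..} s \<Longrightarrow> continuous_on {0..} (\<lambda>t. U t (s t))"
    and "\<And>s w t. t > 0 \<Longrightarrow> t \<notin> range ts \<Longrightarrow>
      (s has_vector_derivative - w - \<beta> *\<^sub>R laplacian (adj (E (\<sigma> t))) (s t)) (at t) \<Longrightarrow>
      \<exists>U'. ((\<lambda>t. U t (s t)) has_real_derivative U') (at t) \<and>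
        U' \<le> - c * (norm (P_perp (s t)))\<^sup>2 + K * (norm w)\<^sup>2"
proof -
  obtain \<tau> where \<tau>: "\<tau> > 0" "\<And>j. ts (Suc j) - ts j \<ge> \<tau>" and ts0: "ts 0 = 0"
    and const: "\<And>j t. t \<in> {ts j..<ts (Suc j)} \<Longrightarrow> \<sigma> t = \<sigma> (ts j)"
    using signal unfolding switching_signal_def by blast
  interpret A: switched_weight ts \<tau> "\<lambda>t. adj (E (\<sigma> t)) i j" for i j
  proof
    show "adj (E (\<sigma> t)) i j = adj (E (\<sigma> (ts k))) i j" if "ts k \<le> t" "t < ts (Suc k)" for k t
      using const[of t k] that by simp
  qed (use \<tau> ts0 in \<open>auto simp: adj_def\<close>)
  \<comment> \<open>The window is longer than \<open>T\<close> so that every edge of the union graph is active in it for a time \<open>\<tau>\<close>.\<close>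
  define T' where "T' = T + 2 * \<tau>"
  have "T' > 0" using \<open>T > 0\<close> \<tau> by (simp add: T'_def)
  define N where "N = real CARD('v)"
  have N: "N > 0" by (simp add: N_def)
  define M where "M = T'\<^sup>2"
  have M: "M > 0" using \<open>T' > 0\<close> by (simp add: M_def)
  define A where "A = (\<lambda>t i j. A.window_weight i j T' t)"
  have A_bounds: "0 \<le> A t i j" "A t i j \<le> M" if "t \<ge> 0" for t i j
    using A.window_weight_bounds[OF that \<open>T' > 0\<close>] by (auto simp: A_def M_def)
  define G where "G = (\<lambda>t i j. A.activity i j (t + T') - A.activity i j t)"
  define c0 where "c0 = \<tau> / N ^ 5"
  have c0: "c0 > 0" using \<tau> N by (simp add: c0_def)
  have excitation: "c0 * (norm (P_perp s))\<^sup>2 \<le> dirichlet (G t) s" if "t \<ge> 0" for t and s :: "real^'n^'v"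
    unfolding c0_def N_def
  proof (rule connected_dirichlet_ge)
    show "connected_digraph (union_graph E \<sigma> {t + \<tau>..<t + \<tau> + T})"
      using conn[of "t + \<tau>"] that \<tau> by simp
    show "0 \<le> G t i j" for i j
      unfolding G_def using A.activity_diff_bounds(1)[of t "t + T'"] that \<open>T' > 0\<close> by simp
    show "\<tau> \<le> G t i j" if edge: "(j, i) \<in> union_graph E \<sigma> {t + \<tau>..<t + \<tau> + T}" for i j
    proof -
      obtain u where "u \<in> {t + \<tau>..<t + \<tau> + T}" "(j, i) \<in> E (\<sigma> u)"
        using edge unfolding union_graph_def by blast
      moreover from this(2) have "adj (E (\<sigma> u)) i j = 1"
        by (simp add: adj_def)
      ultimately show ?thesis
        unfolding G_def T'_def using \<open>t \<ge> 0\<close> by (intro A.activity_gain)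
    qed
  qed (rule \<tau>)
  define K1 where "K1 = 8 * M * N\<^sup>2"
  define K3 where "K3 = K1 * (\<beta> * N\<^sup>2)"
  \<comment> \<open>\<open>4 M N\<^sup>2\<close> keeps \<open>U\<close> above \<open>\<parallel>P_perp s\<parallel>\<^sup>2\<close>; the last summand absorbs the loss \<open>T' q\<close> and the cross term with \<open>sqrt q\<close>.\<close>
  define \<kappa> where "\<kappa> = 1 + 4 * M * N\<^sup>2 + (T' + K3\<^sup>2 / c0) / \<beta>"
  have \<kappa>: "\<kappa> \<ge> 1 + 4 * M * N\<^sup>2" "\<kappa> * \<beta> \<ge> T' + K3\<^sup>2 / c0"
    using \<open>T' > 0\<close> \<open>\<beta> > 0\<close> c0 M by (auto simp: \<kappa>_def field_simps)
  have "\<kappa> > 0"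
    using \<kappa>(1) M by (intro less_le_trans[OF _ \<kappa>(1)] add_pos_nonneg) auto
  define U where "U = (\<lambda>t (s :: real^'n^'v). \<kappa> * (norm (P_perp s))\<^sup>2 - dirichlet (A t) s)"
  have K1: "K1 \<ge> 0" using M by (simp add: K1_def)
  show thesis
  proof (rule that[of "c0 / 2" "(2 * \<kappa> + K1)\<^sup>2 / c0" \<kappa> U])
    show "(norm (P_perp s))\<^sup>2 \<le> U t s \<and> U t s \<le> \<kappa> * (norm (P_perp s))\<^sup>2" if "t \<ge> 0" for t s
    proof -
      have "(1 + 4 * M * N\<^sup>2) * (norm (P_perp s))\<^sup>2 \<le> \<kappa> * (norm (P_perp s))\<^sup>2"
        using \<kappa>(1) by (rule mult_right_mono) simp
      moreover have "dirichlet (A t) s \<le> 4 * M * N\<^sup>2 * (norm (P_perp s))\<^sup>2"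
        unfolding N_def using A_bounds[OF that] M by (intro dirichlet_le) auto
      moreover have "0 \<le> dirichlet (A t) s"
        using A_bounds[OF that] by (intro dirichlet_nonneg)
      ultimately show ?thesis
        by (simp add: U_def algebra_simps)
    qed
    show "continuous_on {0..} (\<lambda>t. U t (s t))" if "continuous_on {0..} s" for s
    proof -
      have "continuous_on {0..} (\<lambda>t. A t i j)" for i j
        unfolding A_def by (rule A.continuous_window_weight[OF \<open>T' > 0\<close>])
      moreover have "continuous_on {0..} (\<lambda>t. P_perp (s t))"
        by (rule bounded_linear.continuous_on[OF bounded_linear_P_perp that])
      ultimately show ?thesis
        unfolding U_def dirichlet_def
        by (intro continuous_intros that)
    qed
    show "\<exists>U'. ((\<lambda>t. U t (s t)) has_real_derivative U') (at t) \<and>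
        U' \<le> - (c0 / 2) * (norm (P_perp (s t)))\<^sup>2 + (2 * \<kappa> + K1)\<^sup>2 / c0 * (norm w)\<^sup>2"
      if t: "t > 0" "t \<notin> range ts"
        and s: "(s has_vector_derivative - w - \<beta> *\<^sub>R laplacian (adj (E (\<sigma> t))) (s t)) (at t)" for s w t
    proof -
      define a where "a = adj (E (\<sigma> t))"
      define s' where "s' = - w - \<beta> *\<^sub>R laplacian a (s t)"
      define y where "y = P_perp (s t)"
      define Y where "Y = norm y"
      define Z where "Z = norm w"
      define q where "q = dirichlet a (s t)"
      define R where "R = sqrt q"
      define B where "B = (\<Sum>i\<in>UNIV. \<Sum>j\<in>UNIV. A t i j * ((s t $ i - s t $ j) \<bullet> (s' $ i - s' $ j)))"
      have nonneg: "0 \<le> Y" "0 \<le> Z" "0 \<le> R" "R\<^sup>2 = q"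
        by (auto simp: Y_def Z_def R_def q_def a_def adj_def dirichlet_nonneg)
      have s': "(s has_vector_derivative s') (at t)"
        using s by (simp add: s'_def a_def)
      have "((\<lambda>t. (norm (P_perp (s t)))\<^sup>2) has_real_derivative 2 * (y \<bullet> P_perp s')) (at t)"
        unfolding y_def
        by (intro has_real_derivative_norm_power2
            bounded_linear.has_vector_derivative[OF bounded_linear_P_perp s'])
      moreover have "((\<lambda>t. dirichlet (A t) (s t)) has_real_derivative
          dirichlet (\<lambda>i j. G t i j - T' * a i j) (s t) + 2 * B) (at t)"
        unfolding B_def A_def G_def a_def
        by (intro dirichlet_has_real_derivative s' A.window_weight_deriv t \<open>T' > 0\<close>)
      ultimately have deriv: "((\<lambda>t. U t (s t)) has_real_derivative
          \<kappa> * (2 * (y \<bullet> P_perp s')) - (dirichlet (\<lambda>i j. G t i j - T' * a i j) (s t) + 2 * B)) (at t)"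
        unfolding U_def by (intro DERIV_diff DERIV_cmult)
      have e1: "y \<bullet> P_perp s' = - (y \<bullet> w) - \<beta> * (y \<bullet> laplacian a (s t))"
        unfolding y_def inner_P_perp by (simp add: s'_def inner_diff_right)
      have e2: "2 * (y \<bullet> laplacian a (s t)) = q"
        unfolding y_def q_def a_def using bal[of t] t by (intro balanced_inner_laplacian) auto
      have e3: "- (y \<bullet> w) \<le> Y * Z"
        using Cauchy_Schwarz_ineq2[of y w] by (simp add: Y_def Z_def)
      have "2 * (y \<bullet> P_perp s') = 2 * - (y \<bullet> w) - \<beta> * (2 * (y \<bullet> laplacian a (s t)))"
        unfolding e1 by (simp add: algebra_simps)
      then have d1: "2 * (y \<bullet> P_perp s') \<le> 2 * (Y * Z) - \<beta> * R\<^sup>2"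
        using e3 unfolding e2 nonneg(4) by linarith
      have d2: "c0 * Y\<^sup>2 - T' * R\<^sup>2 \<le> dirichlet (\<lambda>i j. G t i j - T' * a i j) (s t)"
        unfolding dirichlet_linear nonneg(4) using excitation[of t "s t"] t
        by (simp add: q_def Y_def y_def)
      have "norm s' \<le> Z + \<beta> * norm (laplacian a (s t))"
        using norm_triangle_ineq4[of "- w" "\<beta> *\<^sub>R laplacian a (s t)"] \<open>\<beta> > 0\<close> by (simp add: s'_def Z_def)
      also have "\<dots> \<le> Z + \<beta> * (N\<^sup>2 * R)"
        unfolding N_def R_def q_def a_def using \<open>\<beta> > 0\<close> by (intro add_left_mono mult_left_mono norm_laplacian_le) auto
      finally have ns': "norm s' \<le> Z + \<beta> * (N\<^sup>2 * R)" .
      have "\<bar>B\<bar> \<le> 4 * M * N\<^sup>2 * Y * norm s'"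
        unfolding B_def N_def Y_def y_def using A_bounds[of t] t by (intro dirichlet_bilinear_bound) auto
      also have "\<dots> \<le> 4 * M * N\<^sup>2 * Y * (Z + \<beta> * (N\<^sup>2 * R))"
        using ns' nonneg M by (intro mult_left_mono) auto
      finally have d3: "- (2 * B) \<le> K1 * (Y * Z) + K3 * (Y * R)"
        by (simp add: K1_def K3_def algebra_simps abs_le_iff)
      have "\<kappa> * (2 * (y \<bullet> P_perp s')) \<le> \<kappa> * (2 * (Y * Z) - \<beta> * R\<^sup>2)"
        using d1 \<open>\<kappa> > 0\<close> by (intro mult_left_mono) auto
      then have "\<kappa> * (2 * (y \<bullet> P_perp s')) - (dirichlet (\<lambda>i j. G t i j - T' * a i j) (s t) + 2 * B)
          \<le> \<kappa> * (2 * (Y * Z) - \<beta> * R\<^sup>2) - (c0 * Y\<^sup>2 - T' * R\<^sup>2) + (K1 * (Y * Z) + K3 * (Y * R))"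
        using d2 d3 by linarith
      also have "\<dots> = (2 * \<kappa> + K1) * (Y * Z) + K3 * (Y * R) - c0 * Y\<^sup>2 - (\<kappa> * \<beta> - T') * R\<^sup>2"
        by (simp add: algebra_simps)
      also have "\<dots> \<le> - (c0 / 2) * Y\<^sup>2 + (2 * \<kappa> + K1)\<^sup>2 / c0 * Z\<^sup>2"
      proof -
        have "(2 * \<kappa> + K1) * (Y * Z) \<le> c0 / 4 * Y\<^sup>2 + (2 * \<kappa> + K1)\<^sup>2 / c0 * Z\<^sup>2"
          and "K3 * (Y * R) \<le> c0 / 4 * Y\<^sup>2 + K3\<^sup>2 / c0 * R\<^sup>2"
          by (rule young[OF c0])+
        moreover have "K3\<^sup>2 / c0 * R\<^sup>2 \<le> (\<kappa> * \<beta> - T') * R\<^sup>2"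
          using \<kappa>(2) by (intro mult_right_mono) auto
        moreover have "c0 / 4 * Y\<^sup>2 + c0 / 4 * Y\<^sup>2 - c0 * Y\<^sup>2 = - (c0 / 2) * Y\<^sup>2"
          by (simp add: field_simps)
        ultimately show ?thesis by linarith
      qed
      finally show ?thesis
        using deriv unfolding Y_def Z_def y_def by blast
    qed
  qed (use c0 \<open>\<kappa> > 0\<close> K1 in auto)
qed

section \<open>The closed loop and its convergence\<close>

text \<open>An abstract form of the Lyapunov estimate: \<open>X\<close>, \<open>Y\<close>, \<open>Z\<close> stand for the norms of \<open>x - x\<^sup>*\<close>,
\<open>P_perp s\<close> and \<open>w\<close>, \<open>U\<close> and \<open>U'\<close> for the consensus Lyapunov function and its derivative, \<open>p1\<close> and \<open>p2\<close> for
the inner products of \<open>w\<close> and \<open>x - x\<^sup>*\<close> with their derivatives.\<close>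

definition dissipative :: "real \<Rightarrow> real \<Rightarrow> real \<Rightarrow> real \<Rightarrow> real \<Rightarrow> real \<Rightarrow> real \<Rightarrow> real \<Rightarrow> real \<Rightarrow> bool" where
  "dissipative \<alpha> c K \<kappa> \<mu> b \<delta> k r \<longleftrightarrow> (\<forall>X Y Z U U' p1 p2.
      0 \<le> X \<and> 0 \<le> Y \<and> 0 \<le> Z \<and> U \<le> \<kappa> * Y\<^sup>2 \<and> U' \<le> - c * Y\<^sup>2 + K * Z\<^sup>2 \<and>
      p1 \<le> - \<alpha> * Z\<^sup>2 + \<delta> * b * Z * (X + Y + Z) \<and>
      p2 \<le> - \<delta> * \<mu> * X\<^sup>2 + \<delta> * b * X * (Y + Z) \<longrightarrow>
      U' + k * (2 * p1) + 2 * p2 \<le> - r * (U + k * Z\<^sup>2 + X\<^sup>2))"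

text \<open>The choice \<open>2 \<alpha> k = K + 1\<close> makes \<open>k Z\<^sup>2\<close> absorb the input term \<open>K Z\<^sup>2\<close> and leaves \<open>- Z\<^sup>2\<close>. Every
cross term carries a factor \<open>\<delta>\<close>. Those with \<open>X\<close> are split so that \<open>X\<^sup>2\<close> receives \<open>\<delta> \<mu>\<close>, half of the
available \<open>2 \<delta> \<mu>\<close>, because the damping of \<open>X\<close> is itself of order \<open>\<delta>\<close>; what falls on \<open>Y\<^sup>2\<close>
and \<open>Z\<^sup>2\<close> is \<open>\<delta> B\<close>, which is at most half of the damping there for small \<open>\<delta>\<close>.\<close>

lemma coupled_decay_inequality:
  fixes \<alpha> c K \<kappa> \<mu> b :: real
  assumes "\<alpha> > 0" "c > 0" "K > 0" "\<kappa> > 0" "\<mu> > 0" "b > 0"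
  shows "\<exists>k>0. \<exists>\<delta>s>0. \<forall>\<delta>. 0 < \<delta> \<and> \<delta> < \<delta>s \<longrightarrow>
    (\<exists>r>0. dissipative \<alpha> c K \<kappa> \<mu> b \<delta> k r)"
proof -
  define k where "k = (K + 1) / (2 * \<alpha>)"
  have k: "k > 0" "2 * \<alpha> * k = K + 1"
    using assms by (auto simp: k_def)
  define p where "p = 2 * (k + 1) * b"
  define B where "B = p\<^sup>2 / (2 * \<mu>) + 2 * p"
  have p: "p > 0" "2 * k * b \<le> p" "2 * b \<le> p"
  proof -
    show "p > 0" using k(1) assms(6) by (simp add: p_def)
  qed (use k(1) assms(6) in \<open>simp_all add: p_def distrib_right\<close>)
  have B: "B > 0" using p assms by (simp add: B_def add_pos_pos)
  define \<delta>s where "\<delta>s = min c 1 / (2 * B)"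
  show ?thesis
  proof (rule exI[of _ k], intro conjI k(1), rule exI[of _ \<delta>s], intro conjI allI impI)
    show "\<delta>s > 0" using assms B by (simp add: \<delta>s_def)
    fix \<delta> assume "0 < \<delta> \<and> \<delta> < \<delta>s"
    then have \<delta>: "0 < \<delta>" "\<delta> < \<delta>s" by auto
    have "\<delta> * B \<le> min c 1 / 2"
      using \<delta> B by (simp add: \<delta>s_def field_simps)
    then have \<delta>B: "\<delta> * B \<le> c / 2" "\<delta> * B \<le> 1 / 2"
      using assms by auto
    define r where "r = min (min (c / (2 * \<kappa>)) (1 / (2 * k))) (\<delta> * \<mu>)"
    have r: "r > 0" "r * \<kappa> \<le> c / 2" "r * k \<le> 1 / 2" "r \<le> \<delta> * \<mu>"
    proof -
      show "r > 0" using assms k \<delta> by (simp add: r_def)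
      have "r * \<kappa> \<le> c / (2 * \<kappa>) * \<kappa>"
        using assms by (intro mult_right_mono) (auto simp: r_def)
      then show "r * \<kappa> \<le> c / 2" using assms by simp
      have "r * k \<le> 1 / (2 * k) * k"
        using k by (intro mult_right_mono) (auto simp: r_def)
      then show "r * k \<le> 1 / 2" using k by simp
    qed (simp add: r_def)
    show "\<exists>r>0. dissipative \<alpha> c K \<kappa> \<mu> b \<delta> k r"
      unfolding dissipative_def
    proof (intro exI[of _ r] conjI r(1) allI impI, elim conjE)
      fix X Y Z U U' p1 p2 :: real
      assume nonneg: "0 \<le> X" "0 \<le> Y" "0 \<le> Z"
        and U: "U \<le> \<kappa> * Y\<^sup>2" and U': "U' \<le> - c * Y\<^sup>2 + K * Z\<^sup>2"
        and p1: "p1 \<le> - \<alpha> * Z\<^sup>2 + \<delta> * b * Z * (X + Y + Z)"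
        and p2: "p2 \<le> - \<delta> * \<mu> * X\<^sup>2 + \<delta> * b * X * (Y + Z)"
      have "2 * (k * p1) \<le> 2 * (k * (- \<alpha> * Z\<^sup>2 + \<delta> * b * Z * (X + Y + Z)))"
        using p1 k by (simp add: mult_left_mono)
      also have "\<dots> = - (K + 1) * Z\<^sup>2 + \<delta> * (2 * k * b * (Z * (X + Y + Z)))"
        unfolding k(2)[symmetric] by (simp add: algebra_simps)
      finally have k1: "2 * (k * p1) \<le> \<dots>" .
      have cross: "2 * k * b * (Z * (X + Y + Z)) + 2 * b * (X * (Y + Z))
          \<le> \<mu> * X\<^sup>2 + B * Y\<^sup>2 + B * Z\<^sup>2"
      proof -
        have "2 * k * b * (Z * (X + Y + Z)) + 2 * b * (X * (Y + Z))
            = p * (X * Z) + 2 * k * b * (Y * Z + Z\<^sup>2) + 2 * b * (X * Y)"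
          by (simp add: p_def algebra_simps power2_eq_square)
        moreover have "2 * k * b * (Y * Z + Z\<^sup>2) \<le> p * (Y * Z + Z\<^sup>2)"
          "2 * b * (X * Y) \<le> p * (X * Y)"
          using p nonneg by (auto intro!: mult_right_mono)
        moreover have "p * (X * Z) \<le> 2 * \<mu> / 4 * X\<^sup>2 + p\<^sup>2 / (2 * \<mu>) * Z\<^sup>2"
          "p * (X * Y) \<le> 2 * \<mu> / 4 * X\<^sup>2 + p\<^sup>2 / (2 * \<mu>) * Y\<^sup>2"
          using assms by (intro young; simp)+
        moreover have "p * (Y * Z + Z\<^sup>2) \<le> p * (2 * Y\<^sup>2 + 2 * Z\<^sup>2)"
        proof (rule mult_left_mono)
          have "0 \<le> (Y - Z)\<^sup>2" by simp
          then have "2 * (Y * Z) \<le> Y\<^sup>2 + Z\<^sup>2"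
            by (simp add: power2_diff)
          then show "Y * Z + Z\<^sup>2 \<le> 2 * Y\<^sup>2 + 2 * Z\<^sup>2"
            using zero_le_power2[of Y] zero_le_power2[of Z] by linarith
        qed (use p in simp)
        moreover have "B * Y\<^sup>2 + B * Z\<^sup>2
            = p\<^sup>2 / (2 * \<mu>) * Y\<^sup>2 + p\<^sup>2 / (2 * \<mu>) * Z\<^sup>2 + p * (2 * Y\<^sup>2 + 2 * Z\<^sup>2)"
          by (simp add: B_def algebra_simps)
        moreover have "2 * \<mu> / 4 * X\<^sup>2 + 2 * \<mu> / 4 * X\<^sup>2 = \<mu> * X\<^sup>2"
          by simp
        ultimately show ?thesis by linarith
      qed
      have "U' + k * (2 * p1) + 2 * p2 \<le> (- c * Y\<^sup>2 + K * Z\<^sup>2)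
          + (- (K + 1) * Z\<^sup>2 + \<delta> * (2 * k * b * (Z * (X + Y + Z))))
          + 2 * (- \<delta> * \<mu> * X\<^sup>2 + \<delta> * b * X * (Y + Z))"
        using U' k1 p2 by simp
      also have "\<dots> = - c * Y\<^sup>2 - Z\<^sup>2 - 2 * (\<delta> * \<mu>) * X\<^sup>2
          + \<delta> * (2 * k * b * (Z * (X + Y + Z)) + 2 * b * (X * (Y + Z)))"
        by (simp add: algebra_simps)
      also have "\<dots> \<le> - c * Y\<^sup>2 - Z\<^sup>2 - 2 * (\<delta> * \<mu>) * X\<^sup>2 + \<delta> * (\<mu> * X\<^sup>2 + B * Y\<^sup>2 + B * Z\<^sup>2)"
        using cross \<delta> by (intro add_left_mono mult_left_mono) auto
      also have "\<dots> = - c * Y\<^sup>2 - Z\<^sup>2 - (\<delta> * \<mu>) * X\<^sup>2 + (\<delta> * B) * Y\<^sup>2 + (\<delta> * B) * Z\<^sup>2"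
        by (simp add: algebra_simps)
      also have "\<dots> \<le> - (c / 2) * Y\<^sup>2 - 1 / 2 * Z\<^sup>2 - (\<delta> * \<mu>) * X\<^sup>2"
      proof -
        have "(\<delta> * B) * Y\<^sup>2 \<le> c / 2 * Y\<^sup>2" "(\<delta> * B) * Z\<^sup>2 \<le> 1 / 2 * Z\<^sup>2"
          using \<delta>B by (intro mult_right_mono; simp)+
        then show ?thesis by simp
      qed
      also have "\<dots> \<le> - (r * \<kappa>) * Y\<^sup>2 - (r * k) * Z\<^sup>2 - r * X\<^sup>2"
      proof -
        have "r * \<kappa> * Y\<^sup>2 \<le> c / 2 * Y\<^sup>2" "r * k * Z\<^sup>2 \<le> 1 / 2 * Z\<^sup>2" "r * X\<^sup>2 \<le> \<delta> * \<mu> * X\<^sup>2"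
          using r by (intro mult_right_mono; simp)+
        then show ?thesis by simp
      qed
      also have "\<dots> \<le> - r * (U + k * Z\<^sup>2 + X\<^sup>2)"
        using mult_left_mono[OF U, of r] r by (simp add: algebra_simps)
      finally show "U' + k * (2 * p1) + 2 * p2 \<le> - r * (U + k * Z\<^sup>2 + X\<^sup>2)" .
    qed
  qed
qed

lemma (in dwell_times) constant_off_switching:
  fixes f :: "real \<Rightarrow> 'a::real_inner"
  assumes "continuous_on {0..} f"
    and "\<And>t. t > 0 \<Longrightarrow> t \<notin> range ts \<Longrightarrow> (f has_vector_derivative 0) (at t)"
    and "t \<ge> 0"
  shows "f t = f 0"
proof -
  have "(norm (f t - f 0))\<^sup>2 \<le> (norm (f 0 - f 0))\<^sup>2 * exp (- 0 * t)"
  proof (rule exponential_decay_off_switching)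
    show "continuous_on {0..} (\<lambda>t. (norm (f t - f 0))\<^sup>2)"
      by (intro continuous_intros assms)
    fix u assume u: "u > 0" "u \<notin> range ts"
    have "((\<lambda>t. (norm (f t - f 0))\<^sup>2) has_real_derivative 2 * ((f u - f 0) \<bullet> (0 - 0))) (at u)"
      by (intro has_real_derivative_norm_power2 has_vector_derivative_diff assms(2) u
          has_vector_derivative_const)
    then show "\<exists>W'. ((\<lambda>t. (norm (f t - f 0))\<^sup>2) has_real_derivative W') (at u) \<and>
        W' \<le> - 0 * (norm (f u - f 0))\<^sup>2"
      by auto
  qed (rule assms)
  then show ?thesis by simp
qed

lemma exp_converges_imp_bounded:
  assumes "exp_converges r g l" "r > 0"
  shows "bounded (g ` {0..})"
proof -
  obtain C where C: "C \<ge> 0" "\<And>t. t \<ge> 0 \<Longrightarrow> norm (g t - l) \<le> C * exp (- r * t)"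
    using assms unfolding exp_converges_def by blast
  have "norm (g t) \<le> norm l + C" if "t \<ge> 0" for t
  proof -
    have "norm (g t) \<le> norm l + norm (g t - l)"
      using norm_triangle_sub[of "g t" l] by simp
    also have "norm (g t - l) \<le> C * 1"
      using assms that by (intro order_trans[OF C(2)[OF that]] mult_left_mono C) auto
    finally show ?thesis by simp
  qed
  then show ?thesis
    by (intro boundedI[where B = "norm l + C"]) auto
qed

lemma exp_convergesI:
  assumes "C \<ge> 0" "\<And>t. t \<ge> 0 \<Longrightarrow> norm (g t - l) \<le> C * exp (- r * t)"
  shows "exp_converges r g l"
  using assms unfolding exp_converges_def by blast

text \<open>Write the extended pseudo-gradient as \<open>F x\<close> plus an error that is Lipschitz in the distance of \<open>s\<close>
from the exact aggregate, and use that \<open>F\<close> vanishes at \<open>xs\<close>.\<close>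

lemma ext_pseudo_gradient_estimates:
  fixes \<phi> :: "'v::finite \<Rightarrow> real^'n \<Rightarrow> real^'n"
  assumes phi_C1: "\<And>i. C1_map (\<phi> i)"
    and fb_diff: "\<And>i p. (\<lambda>(y, s). fb i y s) differentiable (at p)"
    and mono: "\<And>x x'. (x - x') \<bullet> (pseudo_gradient \<phi> fb x - pseudo_gradient \<phi> fb x')
      \<ge> \<mu> * (norm (x - x'))\<^sup>2"
    and lip: "\<And>x x'. norm (pseudo_gradient \<phi> fb x - pseudo_gradient \<phi> fb x') \<le> \<theta> * norm (x - x')"
    and ext: "\<And>x s s'. norm (ext_pseudo_gradient \<phi> fb x s - ext_pseudo_gradient \<phi> fb x s')
      \<le> \<theta>h * norm (s - s')"
    and zero: "pseudo_gradient \<phi> fb xs = 0"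
  shows "norm (ext_pseudo_gradient \<phi> fb x s)
      \<le> \<theta> * norm (x - xs) + \<theta>h * norm (s - P_avg (stack \<phi> x))"
    and "- ((x - xs) \<bullet> ext_pseudo_gradient \<phi> fb x s)
      \<le> - \<mu> * (norm (x - xs))\<^sup>2 + \<theta>h * norm (x - xs) * norm (s - P_avg (stack \<phi> x))"
proof -
  define F where "F = pseudo_gradient \<phi> fb x"
  define e where "e = ext_pseudo_gradient \<phi> fb x s - F"
  have "F = ext_pseudo_gradient \<phi> fb x (P_avg (stack \<phi> x))"
    unfolding F_def P_avg_stack by (rule pseudo_gradient_eq_ext[OF phi_C1 fb_diff])
  then have e: "norm e \<le> \<theta>h * norm (s - P_avg (stack \<phi> x))"
    using ext by (simp add: e_def)
  have split: "ext_pseudo_gradient \<phi> fb x s = F + e"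
    by (simp add: e_def)
  have "norm F \<le> \<theta> * norm (x - xs)"
    using lip[of x xs] by (simp add: F_def zero)
  with e show "norm (ext_pseudo_gradient \<phi> fb x s)
      \<le> \<theta> * norm (x - xs) + \<theta>h * norm (s - P_avg (stack \<phi> x))"
    unfolding split using norm_triangle_ineq[of F e] by linarith
  have "- ((x - xs) \<bullet> e) \<le> norm (x - xs) * norm e"
    using Cauchy_Schwarz_ineq2[of "x - xs" e] by simp
  also have "\<dots> \<le> norm (x - xs) * (\<theta>h * norm (s - P_avg (stack \<phi> x)))"
    using e by (intro mult_left_mono) auto
  finally show "- ((x - xs) \<bullet> ext_pseudo_gradient \<phi> fb x s)
      \<le> - \<mu> * (norm (x - xs))\<^sup>2 + \<theta>h * norm (x - xs) * norm (s - P_avg (stack \<phi> x))"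
    unfolding split inner_add_right using mono[of x xs] by (simp add: F_def zero mult_ac)
qed

lemma stack_lipschitz:
  assumes "\<And>i. C1_map (\<phi> i)" "\<And>x. onorm (frechet_derivative (stack \<phi>) (at x)) \<le> l"
  shows "norm (stack \<phi> x - stack \<phi> y) \<le> l * norm (x - y)"
  by (rule differentiable_bound[OF convex_UNIV _ assms(2)])
    (auto intro: stack_has_derivative assms has_derivative_at_withinI)

text \<open>The combination of \<open>s\<close> and \<open>\<nu>\<close> whose derivative is free of the graph; it vanishes at the limit
\<open>s = P_avg (stack \<phi> x)\<close>, \<open>\<nu> = \<alpha> P_perp (stack \<phi> x)\<close> belonging to \<open>x\<close>.\<close>

definition fast_error ::
  "('v::finite \<Rightarrow> real^'n \<Rightarrow> real^'n) \<Rightarrow> real \<Rightarrow> real^'n^'v \<Rightarrow> real^'n^'v \<Rightarrow> real^'n^'v \<Rightarrow> real^'n^'v" where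
  "fast_error \<phi> \<alpha> x s \<nu> = \<alpha> *\<^sub>R s + \<nu> - \<alpha> *\<^sub>R stack \<phi> x"

lemma solves_system_derivs:
  assumes sys: "solves_system \<phi> fb E ts \<sigma> \<delta> \<alpha> \<beta> x s \<nu>" and t: "t \<ge> 0" "t \<notin> range ts"
  shows "(x has_vector_derivative - \<delta> *\<^sub>R ext_pseudo_gradient \<phi> fb (x t) (s t)) (at t)"
    and "(s has_vector_derivative
      - fast_error \<phi> \<alpha> (x t) (s t) (\<nu> t) - \<beta> *\<^sub>R laplacian (adj (E (\<sigma> t))) (s t)) (at t)"
    and "(\<nu> has_vector_derivative (\<alpha> * \<beta>) *\<^sub>R laplacian (adj (E (\<sigma> t))) (s t)) (at t)"
proof -
  have comp: "((\<lambda>t. x t $ i) has_vector_derivative - \<delta> *\<^sub>R J \<phi> fb i (x t $ i) (s t $ i)) (at t)"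
    "((\<lambda>t. s t $ i) has_vector_derivative
      - \<alpha> *\<^sub>R (s t $ i - \<phi> i (x t $ i)) - \<beta> *\<^sub>R laplacian (adj (E (\<sigma> t))) (s t) $ i - \<nu> t $ i) (at t)"
    "((\<lambda>t. \<nu> t $ i) has_vector_derivative (\<alpha> * \<beta>) *\<^sub>R laplacian (adj (E (\<sigma> t))) (s t) $ i) (at t)" for i
    using sys t unfolding solves_system_def laplacian_neighbors by auto
  show "(x has_vector_derivative - \<delta> *\<^sub>R ext_pseudo_gradient \<phi> fb (x t) (s t)) (at t)"
    by (rule has_vector_derivative_vecI) (use comp(1) in \<open>simp add: ext_pseudo_gradient_def\<close>)
  have s_eq: "- \<alpha> *\<^sub>R (s t $ i - \<phi> i (x t $ i)) - \<beta> *\<^sub>R laplacian (adj (E (\<sigma> t))) (s t) $ i - \<nu> t $ i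
      = (- fast_error \<phi> \<alpha> (x t) (s t) (\<nu> t) - \<beta> *\<^sub>R laplacian (adj (E (\<sigma> t))) (s t)) $ i" for i
    by (simp add: fast_error_def stack_def scaleR_diff_right)
  show "(s has_vector_derivative
      - fast_error \<phi> \<alpha> (x t) (s t) (\<nu> t) - \<beta> *\<^sub>R laplacian (adj (E (\<sigma> t))) (s t)) (at t)"
    by (rule has_vector_derivative_vecI) (rule comp(2)[unfolded s_eq])
  show "(\<nu> has_vector_derivative (\<alpha> * \<beta>) *\<^sub>R laplacian (adj (E (\<sigma> t))) (s t)) (at t)"
    by (rule has_vector_derivative_vecI) (use comp(3) in simp)
qed

text \<open>The term \<open>- \<alpha> \<beta> L\<close> from \<open>\<alpha> s'\<close> cancels against \<open>\<nu>'\<close>.\<close>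

lemma fast_error_deriv:
  fixes \<alpha> \<beta> :: real
  assumes x: "(x has_vector_derivative x') (at t)"
    and s: "(s has_vector_derivative - fast_error \<phi> \<alpha> (x t) (s t) (\<nu> t) - \<beta> *\<^sub>R L) (at t)"
    and \<nu>: "(\<nu> has_vector_derivative (\<alpha> * \<beta>) *\<^sub>R L) (at t)"
    and D: "(stack \<phi> has_derivative D) (at (x t))"
  shows "((\<lambda>t. fast_error \<phi> \<alpha> (x t) (s t) (\<nu> t)) has_vector_derivative
    - \<alpha> *\<^sub>R fast_error \<phi> \<alpha> (x t) (s t) (\<nu> t) - \<alpha> *\<^sub>R D x') (at t)"
proof -
  have p: "((\<lambda>t. stack \<phi> (x t)) has_vector_derivative D x') (at t)"
    using has_derivative_compose[OF x[unfolded has_vector_derivative_def] D]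
    unfolding has_vector_derivative_def
    by (simp only: linear_scale[OF has_derivative_linear[OF D]])
  have "((\<lambda>t. fast_error \<phi> \<alpha> (x t) (s t) (\<nu> t)) has_vector_derivative
      \<alpha> *\<^sub>R (- fast_error \<phi> \<alpha> (x t) (s t) (\<nu> t) - \<beta> *\<^sub>R L) + (\<alpha> * \<beta>) *\<^sub>R L - \<alpha> *\<^sub>R D x') (at t)"
    unfolding fast_error_def[abs_def]
    by (intro has_vector_derivative_diff has_vector_derivative_add \<nu> p s[unfolded fast_error_def]
        bounded_linear.has_vector_derivative[OF bounded_linear_scaleR_right])
  then show ?thesis
    by (simp add: scaleR_diff_right)
qed

lemma (in dwell_times) multipliers_average_zero:
  assumes sys: "solves_system \<phi> fb E ts \<sigma> \<delta> \<alpha> \<beta> x s \<nu>" and sum0: "(\<Sum>i\<in>UNIV. \<nu> 0 $ i) = 0"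
    and bal: "\<And>t. t \<ge> 0 \<Longrightarrow> weight_balanced (E (\<sigma> t))" and "t \<ge> 0"
  shows "P_avg (\<nu> t) = 0"
proof -
  have "(\<Sum>i\<in>UNIV. \<nu> t $ i) = (\<Sum>i\<in>UNIV. \<nu> 0 $ i)"
  proof (rule constant_off_switching[OF _ _ \<open>t \<ge> 0\<close>])
    show "continuous_on {0..} (\<lambda>t. \<Sum>i\<in>UNIV. \<nu> t $ i)"
      using sys by (intro continuous_intros) (auto simp: solves_system_def)
    fix u :: real assume u: "u > 0" "u \<notin> range ts"
    have "((\<lambda>t. \<Sum>i\<in>UNIV. \<nu> t $ i) has_vector_derivative
        (\<Sum>i\<in>UNIV. ((\<alpha> * \<beta>) *\<^sub>R laplacian (adj (E (\<sigma> u))) (s u)) $ i)) (at u)"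
      using u by (intro has_vector_derivative_sum has_vector_derivative_nth
          solves_system_derivs(3)[OF sys]) auto
    moreover have "(\<Sum>i\<in>UNIV. ((\<alpha> * \<beta>) *\<^sub>R laplacian (adj (E (\<sigma> u))) (s u)) $ i) = 0"
      using balanced_sum_laplacian_zero[OF bal[of u], of "s u"] u
      by (simp flip: scaleR_sum_right)
    ultimately show "((\<lambda>t. \<Sum>i\<in>UNIV. \<nu> t $ i) has_vector_derivative 0) (at u)"
      by simp
  qed
  then show ?thesis
    using sum0 by (simp add: vec_eq_iff P_avg_nth)
qed

text \<open>The average of \<open>s\<close> misses the true aggregate by \<open>P_avg w / \<alpha>\<close>, since \<open>\<nu>\<close> has average zero.\<close>

lemma aggregate_tracking_error:
  assumes "\<alpha> > 0" "P_avg \<nu> = 0"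
  shows "norm (s - P_avg (stack \<phi> x)) \<le> norm (P_perp s) + norm (fast_error \<phi> \<alpha> x s \<nu>) / \<alpha>"
proof -
  define w where "w = fast_error \<phi> \<alpha> x s \<nu>"
  have "P_avg w = \<alpha> *\<^sub>R (P_avg s - P_avg (stack \<phi> x))"
    by (simp add: w_def fast_error_def P_avg_add P_avg_diff P_avg_scaleR assms(2) scaleR_diff_right)
  then have "s - P_avg (stack \<phi> x) = P_perp s + (1 / \<alpha>) *\<^sub>R P_avg w"
    using assms(1) by (simp add: P_perp_def)
  then have "norm (s - P_avg (stack \<phi> x)) \<le> norm (P_perp s) + norm ((1 / \<alpha>) *\<^sub>R P_avg w)"
    by (simp only: norm_triangle_ineq)
  also have "norm ((1 / \<alpha>) *\<^sub>R P_avg w) \<le> norm w / \<alpha>"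
    using assms(1) norm_P_avg_le[of w] by (simp add: divide_right_mono)
  finally show ?thesis by (simp add: w_def)
qed

text \<open>The original variables are recovered from the three errors by
\<open>s - P_avg (stack \<phi> xs) = (s - P_avg (stack \<phi> x)) + P_avg (stack \<phi> x - stack \<phi> xs)\<close> and
\<open>\<nu> - \<alpha> P_perp (stack \<phi> xs) = w - \<alpha> (s - P_avg (stack \<phi> xs)) + \<alpha> (stack \<phi> x - stack \<phi> xs)\<close>.\<close>

lemma convergence_from_error_decay:
  fixes x s \<nu> :: "real \<Rightarrow> real^'n^'v::finite"
  assumes "\<alpha> > 0" "r > 0" "l \<ge> 0" "C \<ge> 0"
    and lip: "\<And>x y. norm (stack \<phi> x - stack \<phi> y) \<le> l * norm (x - y)"
    and avg: "\<And>t. t \<ge> 0 \<Longrightarrow> P_avg (\<nu> t) = 0"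
    and X: "\<And>t. t \<ge> 0 \<Longrightarrow> norm (x t - xs) \<le> C * exp (- r * t)"
    and Y: "\<And>t. t \<ge> 0 \<Longrightarrow> norm (P_perp (s t)) \<le> C * exp (- r * t)"
    and Z: "\<And>t. t \<ge> 0 \<Longrightarrow> norm (fast_error \<phi> \<alpha> (x t) (s t) (\<nu> t)) \<le> C * exp (- r * t)"
  shows "bounded ((\<lambda>t. (x t, s t, \<nu> t)) ` {0..}) \<and>
    exp_converges r x xs \<and>
    exp_converges r s (P_avg (stack \<phi> xs)) \<and>
    exp_converges r \<nu> (\<alpha> *\<^sub>R P_perp (stack \<phi> xs))"
proof -
  define h where "h = (\<lambda>t. exp (- r * t))"
  define w where "w = (\<lambda>t. fast_error \<phi> \<alpha> (x t) (s t) (\<nu> t))"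
  define p where "p = (\<lambda>t. stack \<phi> (x t))"
  have p_le: "norm (p t - stack \<phi> xs) \<le> l * (C * h t)" if "t \<ge> 0" for t
    unfolding p_def h_def using lip[of "x t" xs] mult_left_mono[OF X[OF that] \<open>l \<ge> 0\<close>] by linarith
  have conv_x: "exp_converges r x xs"
    using X \<open>C \<ge> 0\<close> by (intro exp_convergesI)
  define C2 where "C2 = (1 + 1 / \<alpha> + l) * C"
  have C2: "C2 \<ge> 0"
    using assms by (simp add: C2_def)
  have s_le: "norm (s t - P_avg (stack \<phi> xs)) \<le> C2 * h t" if "t \<ge> 0" for t
  proof -
    have "s t - P_avg (stack \<phi> xs) = (s t - P_avg (p t)) + P_avg (p t - stack \<phi> xs)"
      by (simp add: P_avg_diff)
    then have "norm (s t - P_avg (stack \<phi> xs))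
        \<le> norm (s t - P_avg (p t)) + norm (P_avg (p t - stack \<phi> xs))"
      by (simp only: norm_triangle_ineq)
    also have "\<dots> \<le> (norm (P_perp (s t)) + norm (w t) / \<alpha>) + norm (p t - stack \<phi> xs)"
      unfolding p_def w_def
      by (intro add_mono aggregate_tracking_error norm_P_avg_le \<open>\<alpha> > 0\<close> avg that)
    also have "\<dots> \<le> (C * h t + (C * h t) / \<alpha>) + l * (C * h t)"
      using Y[OF that] Z[OF that] p_le[OF that] \<open>\<alpha> > 0\<close>
      by (intro add_mono divide_right_mono) (auto simp: h_def w_def)
    also have "\<dots> = C2 * h t"
      by (simp add: C2_def algebra_simps)
    finally show ?thesis .
  qed
  have conv_s: "exp_converges r s (P_avg (stack \<phi> xs))"
    using s_le C2 unfolding h_def by (intro exp_convergesI[of C2]) auto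
  define C3 where "C3 = C + \<alpha> * C2 + \<alpha> * (l * C)"
  have \<nu>_le: "norm (\<nu> t - \<alpha> *\<^sub>R P_perp (stack \<phi> xs)) \<le> C3 * h t" if "t \<ge> 0" for t
  proof -
    have "\<nu> t - \<alpha> *\<^sub>R P_perp (stack \<phi> xs)
        = (w t - \<alpha> *\<^sub>R (s t - P_avg (stack \<phi> xs))) + \<alpha> *\<^sub>R (p t - stack \<phi> xs)"
      by (simp add: w_def p_def fast_error_def P_perp_def scaleR_diff_right)
    then have "norm (\<nu> t - \<alpha> *\<^sub>R P_perp (stack \<phi> xs))
        \<le> norm (w t - \<alpha> *\<^sub>R (s t - P_avg (stack \<phi> xs))) + norm (\<alpha> *\<^sub>R (p t - stack \<phi> xs))"
      by (simp only: norm_triangle_ineq)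
    also have "\<dots> \<le> (norm (w t) + norm (\<alpha> *\<^sub>R (s t - P_avg (stack \<phi> xs))))
        + norm (\<alpha> *\<^sub>R (p t - stack \<phi> xs))"
      by (intro add_right_mono norm_triangle_ineq4)
    also have "\<dots> = norm (w t) + \<alpha> * norm (s t - P_avg (stack \<phi> xs)) + \<alpha> * norm (p t - stack \<phi> xs)"
      using \<open>\<alpha> > 0\<close> by simp
    also have "\<dots> \<le> C * h t + \<alpha> * (C2 * h t) + \<alpha> * (l * (C * h t))"
      using Z[OF that] s_le[OF that] p_le[OF that] \<open>\<alpha> > 0\<close>
      by (intro add_mono mult_left_mono) (auto simp: h_def w_def)
    also have "\<dots> = C3 * h t"
      by (simp add: C3_def algebra_simps)
    finally show ?thesis .
  qed
  have conv_\<nu>: "exp_converges r \<nu> (\<alpha> *\<^sub>R P_perp (stack \<phi> xs))"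
    using \<nu>_le assms C2 unfolding h_def by (intro exp_convergesI[of C3]) (auto simp: C3_def)
  have "bounded (x ` {0..} \<times> s ` {0..} \<times> \<nu> ` {0..})"
    using \<open>r > 0\<close> by (intro bounded_Times exp_converges_imp_bounded[OF conv_x]
        exp_converges_imp_bounded[OF conv_s] exp_converges_imp_bounded[OF conv_\<nu>])
  then have "bounded ((\<lambda>t. (x t, s t, \<nu> t)) ` {0..})"
    by (rule bounded_subset) auto
  then show ?thesis
    using conv_x conv_s conv_\<nu> by blast
qed

theorem theorem1:
  fixes \<phi> :: "'v::finite \<Rightarrow> real^'n \<Rightarrow> real^'n"
    and fb :: "'v \<Rightarrow> real^'n \<Rightarrow> real^'n \<Rightarrow> real"
    and E :: "nat \<Rightarrow> ('v \<times> 'v) set"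
    and n0 :: nat and ts :: "nat \<Rightarrow> real" and \<sigma> :: "real \<Rightarrow> nat"
  assumes phi_C1: "\<And>i. C1_map (\<phi> i)"
    and fb_diff: "\<And>i p. (\<lambda>(y, s). fb i y s) differentiable (at p)"
    and n0_pos: "n0 \<ge> 1"
    and no_loops: "\<And>p i. p \<in> {1..n0} \<Longrightarrow> (i, i) \<notin> E p"
    and signal: "switching_signal n0 ts \<sigma>"
    and A1_convex: "\<And>i x. convex_on UNIV (\<lambda>y. cost \<phi> fb i (upd x i y))"
    and A1_C1: "\<And>i x. C1_fun (\<lambda>y. cost \<phi> fb i (upd x i y))"
    and A1_monotone: "\<exists>\<mu>>0. \<forall>x x'.
          (x - x') \<bullet> (pseudo_gradient \<phi> fb x - pseudo_gradient \<phi> fb x') \<ge> \<mu> * (norm (x - x'))\<^sup>2"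
    and A2: "\<exists>\<theta>>0. \<forall>x x'.
          norm (pseudo_gradient \<phi> fb x - pseudo_gradient \<phi> fb x') \<le> \<theta> * norm (x - x')"
    and A3_ext: "\<exists>\<theta>h>0. \<forall>x s s'.
          norm (ext_pseudo_gradient \<phi> fb x s - ext_pseudo_gradient \<phi> fb x s') \<le> \<theta>h * norm (s - s')"
    and A3_phi: "\<exists>l>0. \<forall>x. onorm (frechet_derivative (stack \<phi>) (at x)) \<le> l"
    and A4_connected: "\<exists>T>0. \<forall>t\<ge>0. connected_digraph (union_graph E \<sigma> {t..<t + T})"
    and A4_balanced: "\<And>t. t \<ge> 0 \<Longrightarrow> weight_balanced (E (\<sigma> t))"
  shows "(\<exists>!xs. nash_equilibrium \<phi> fb xs) \<and>
    (\<forall>xs. nash_equilibrium \<phi> fb xs \<longrightarrow>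
      (\<forall>\<alpha>>0. \<forall>\<beta>>0. \<exists>\<delta>s>0. \<forall>\<delta>. 0 < \<delta> \<and> \<delta> < \<delta>s \<longrightarrow>
        (\<exists>r>0. \<forall>x s \<nu>.
          solves_system \<phi> fb E ts \<sigma> \<delta> \<alpha> \<beta> x s \<nu> \<and> (\<Sum>i\<in>UNIV. \<nu> 0 $ i) = 0 \<longrightarrow>
            bounded ((\<lambda>t. (x t, s t, \<nu> t)) ` {0..}) \<and>
            exp_converges r x xs \<and>
            exp_converges r s (P_avg (stack \<phi> xs)) \<and>
            exp_converges r \<nu> (\<alpha> *\<^sub>R P_perp (stack \<phi> xs)))))"
proof -
  obtain \<mu> where \<mu>: "\<mu> > 0" and mono: "\<And>x x'.
      (x - x') \<bullet> (pseudo_gradient \<phi> fb x - pseudo_gradient \<phi> fb x') \<ge> \<mu> * (norm (x - x'))\<^sup>2"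
    using A1_monotone by blast
  obtain \<theta> where \<theta>: "\<theta> > 0" and lip: "\<And>x x'.
      norm (pseudo_gradient \<phi> fb x - pseudo_gradient \<phi> fb x') \<le> \<theta> * norm (x - x')"
    using A2 by blast
  obtain \<theta>h where \<theta>h: "\<theta>h > 0" and ext: "\<And>x s s'.
      norm (ext_pseudo_gradient \<phi> fb x s - ext_pseudo_gradient \<phi> fb x s') \<le> \<theta>h * norm (s - s')"
    using A3_ext by blast
  obtain l where l: "l > 0" and onorm_le: "\<And>x. onorm (frechet_derivative (stack \<phi>) (at x)) \<le> l"
    using A3_phi by blast
  obtain T where T: "T > 0" "\<And>t. t \<ge> 0 \<Longrightarrow> connected_digraph (union_graph E \<sigma> {t..<t + T})"
    using A4_connected by blast
  obtain \<tau> where \<tau>: "\<tau> > 0" "\<And>j. ts (Suc j) - ts j \<ge> \<tau>" and ts0: "ts 0 = 0"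
    using signal unfolding switching_signal_def by blast
  interpret dwell_times ts \<tau>
    by standard (use \<tau> ts0 in auto)
  note nash_iff = nash_equilibrium_iff_zero[OF A1_convex A1_C1]
  have unique: "\<exists>!xs. nash_equilibrium \<phi> fb xs"
    unfolding nash_iff by (rule strongly_monotone_lipschitz_unique_zero[OF mono \<mu> lip \<theta>])
  have main: "\<exists>\<delta>s>0. \<forall>\<delta>. 0 < \<delta> \<and> \<delta> < \<delta>s \<longrightarrow>
        (\<exists>r>0. \<forall>x s \<nu>.
          solves_system \<phi> fb E ts \<sigma> \<delta> \<alpha> \<beta> x s \<nu> \<and> (\<Sum>i\<in>UNIV. \<nu> 0 $ i) = 0 \<longrightarrow>
            bounded ((\<lambda>t. (x t, s t, \<nu> t)) ` {0..}) \<and>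
            exp_converges r x xs \<and>
            exp_converges r s (P_avg (stack \<phi> xs)) \<and>
            exp_converges r \<nu> (\<alpha> *\<^sub>R P_perp (stack \<phi> xs)))"
    if nash: "nash_equilibrium \<phi> fb xs" and \<alpha>: "\<alpha> > 0" and \<beta>: "\<beta> > 0" for xs \<alpha> \<beta>
  proof -
    have zero: "pseudo_gradient \<phi> fb xs = 0"
      using nash nash_iff by blast
    note estimates = ext_pseudo_gradient_estimates[OF phi_C1 fb_diff mono lip ext zero]
    show ?thesis
    proof (rule switched_consensus_lyapunov[OF signal T(1) \<beta>, where E = E])
      show "connected_digraph (union_graph E \<sigma> {t..<t + T})" if "t \<ge> 0" for t
        by (rule T(2)[OF that])
      show "weight_balanced (E (\<sigma> t))" if "t \<ge> 0" for t
        by (rule A4_balanced[OF that])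
    next
      fix c K \<kappa> :: real and U :: "real \<Rightarrow> real^'n^'v \<Rightarrow> real"
      assume pos: "c > 0" "K > 0" "\<kappa> > 0"
        and U_bounds: "\<And>t s. t \<ge> 0 \<Longrightarrow> (norm (P_perp s))\<^sup>2 \<le> U t s \<and> U t s \<le> \<kappa> * (norm (P_perp s))\<^sup>2"
        and U_cont: "\<And>s. continuous_on {0..} s \<Longrightarrow> continuous_on {0..} (\<lambda>t. U t (s t))"
        and U_deriv: "\<And>s w t. t > 0 \<Longrightarrow> t \<notin> range ts \<Longrightarrow>
          (s has_vector_derivative - w - \<beta> *\<^sub>R laplacian (adj (E (\<sigma> t))) (s t)) (at t) \<Longrightarrow>
          \<exists>U'. ((\<lambda>t. U t (s t)) has_real_derivative U') (at t) \<and>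
            U' \<le> - c * (norm (P_perp (s t)))\<^sup>2 + K * (norm w)\<^sup>2"
      \<comment> \<open>A common bound: \<open>\<parallel>g\<parallel> \<le> m (X + Y + Z)\<close>, and \<open>b\<close> bounds both couplings that it causes.\<close>
      define m where "m = \<theta> + \<theta>h + \<theta>h / \<alpha>"
      have m: "m > 0" "\<theta> \<le> m" "\<theta>h \<le> m" "\<theta>h / \<alpha> \<le> m"
        using \<theta> \<theta>h divide_pos_pos[OF \<theta>h \<alpha>] by (auto simp: m_def)
      define b where "b = m + \<alpha> * l * m"
      have b: "b > 0" "m \<le> b" "\<alpha> * l * m \<le> b"
        using m \<alpha> l by (auto simp: b_def add_pos_pos)
      obtain k \<delta>s where k: "k > 0" and \<delta>s: "\<delta>s > 0"
        and decay: "\<And>\<delta>. 0 < \<delta> \<Longrightarrow> \<delta> < \<delta>s \<Longrightarrow> \<exists>r>0. dissipative \<alpha> c K \<kappa> \<mu> b \<delta> k r"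
        using coupled_decay_inequality[OF \<alpha> pos \<mu> b(1)] by blast
      show ?thesis
      proof (rule exI[of _ \<delta>s], rule conjI[OF \<delta>s], intro allI impI, elim conjE)
        fix \<delta> assume \<delta>: "0 < \<delta>" "\<delta> < \<delta>s"
        obtain r where r: "r > 0" and W_ineq: "dissipative \<alpha> c K \<kappa> \<mu> b \<delta> k r"
          using decay[OF \<delta>] by blast
        show "\<exists>r>0. \<forall>x s \<nu>.
            solves_system \<phi> fb E ts \<sigma> \<delta> \<alpha> \<beta> x s \<nu> \<and> (\<Sum>i\<in>UNIV. \<nu> 0 $ i) = 0 \<longrightarrow>
              bounded ((\<lambda>t. (x t, s t, \<nu> t)) ` {0..}) \<and>
              exp_converges r x xs \<and>
              exp_converges r s (P_avg (stack \<phi> xs)) \<and>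
              exp_converges r \<nu> (\<alpha> *\<^sub>R P_perp (stack \<phi> xs))"
        \<comment> \<open>The Lyapunov function decays at rate \<open>r\<close> and is quadratic in the errors, hence the rate \<open>r / 2\<close>.\<close>
        proof (rule exI[of _ "r / 2"], rule conjI[OF half_gt_zero[OF r]], intro allI impI, goal_cases)
          case (1 x s \<nu>)
          then have sys: "solves_system \<phi> fb E ts \<sigma> \<delta> \<alpha> \<beta> x s \<nu>" and sum0: "(\<Sum>i\<in>UNIV. \<nu> 0 $ i) = 0"
            by auto
          define e where "e = (\<lambda>t. x t - xs)"
          define w where "w = (\<lambda>t. fast_error \<phi> \<alpha> (x t) (s t) (\<nu> t))"
          define g where "g = (\<lambda>t. ext_pseudo_gradient \<phi> fb (x t) (s t))"
          define X where "X = (\<lambda>t. norm (e t))"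
          define Y where "Y = (\<lambda>t. norm (P_perp (s t)))"
          define Z where "Z = (\<lambda>t. norm (w t))"
          have nonneg: "0 \<le> X t" "0 \<le> Y t" "0 \<le> Z t" for t
            by (auto simp: X_def Y_def Z_def)
          have cont: "continuous_on {0..} x" "continuous_on {0..} s" "continuous_on {0..} \<nu>"
            using sys by (auto simp: solves_system_def)
          have cont_p: "continuous_on {0..} (\<lambda>t. stack \<phi> (x t))"
            by (rule continuous_on_compose2[OF _ cont(1), of UNIV])
              (auto intro!: continuous_at_imp_continuous_on has_derivative_continuous
                stack_has_derivative phi_C1)
          have deriv: "(x has_vector_derivative - \<delta> *\<^sub>R g t) (at t)"
            "(s has_vector_derivative - fast_error \<phi> \<alpha> (x t) (s t) (\<nu> t)
              - \<beta> *\<^sub>R laplacian (adj (E (\<sigma> t))) (s t)) (at t)"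
            "(\<nu> has_vector_derivative (\<alpha> * \<beta>) *\<^sub>R laplacian (adj (E (\<sigma> t))) (s t)) (at t)"
            if "t > 0" "t \<notin> range ts" for t
            using solves_system_derivs[OF sys, of t] that by (simp_all add: g_def)
          have avg_\<nu>: "P_avg (\<nu> t) = 0" if "t \<ge> 0" for t
            by (rule multipliers_average_zero[OF sys sum0 A4_balanced that])
          define W where "W = (\<lambda>t. U t (s t) + k * (norm (w t))\<^sup>2 + (norm (e t))\<^sup>2)"
          have W_decay: "W t \<le> W 0 * exp (- r * t)" if "t \<ge> 0" for t
          proof (rule exponential_decay_off_switching[OF _ _ that])
            show "continuous_on {0..} W"
              unfolding W_def w_def e_def fast_error_def by (intro continuous_intros U_cont cont cont_p)
            fix t :: real assume t: "t > 0" "t \<notin> range ts"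
            define D where "D = frechet_derivative (stack \<phi>) (at (x t))"
            have D: "(stack \<phi> has_derivative D) (at (x t))"
              unfolding D_def by (rule stack_has_derivative[OF phi_C1])
            have deriv_w: "(w has_vector_derivative - \<alpha> *\<^sub>R w t - \<alpha> *\<^sub>R D (- \<delta> *\<^sub>R g t)) (at t)"
              using fast_error_deriv[OF deriv[OF t] D] unfolding w_def .
            have deriv_e: "(e has_vector_derivative - \<delta> *\<^sub>R g t) (at t)"
              unfolding e_def[abs_def] using has_vector_derivative_diff[OF deriv(1)[OF t] has_vector_derivative_const]
              by simp
            obtain U' where U': "((\<lambda>t. U t (s t)) has_real_derivative U') (at t)"
                "U' \<le> - c * (Y t)\<^sup>2 + K * (Z t)\<^sup>2"
              using U_deriv[OF t deriv(2)[OF t]] unfolding Y_def Z_def w_def by blast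
            define p1 where "p1 = w t \<bullet> (- \<alpha> *\<^sub>R w t - \<alpha> *\<^sub>R D (- \<delta> *\<^sub>R g t))"
            define p2 where "p2 = e t \<bullet> (- \<delta> *\<^sub>R g t)"
            have "(W has_real_derivative U' + k * (2 * p1) + 2 * p2) (at t)"
              unfolding W_def p1_def p2_def
              by (intro DERIV_add DERIV_cmult U'(1) has_real_derivative_norm_power2 deriv_w deriv_e)
            moreover have "U' + k * (2 * p1) + 2 * p2 \<le> - r * (U t (s t) + k * (Z t)\<^sup>2 + (X t)\<^sup>2)"
            proof (rule W_ineq[unfolded dissipative_def, rule_format], intro conjI)
              show "U t (s t) \<le> \<kappa> * (Y t)\<^sup>2"
                using U_bounds[of t "s t"] t by (simp add: Y_def)
              have err: "norm (s t - P_avg (stack \<phi> (x t))) \<le> Y t + Z t / \<alpha>"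
                using aggregate_tracking_error[OF \<alpha> avg_\<nu>[of t]] t by (simp add: Y_def Z_def w_def)
              have err': "\<theta>h * norm (s t - P_avg (stack \<phi> (x t))) \<le> m * (Y t + Z t)"
              proof -
                have "\<theta>h * norm (s t - P_avg (stack \<phi> (x t))) \<le> \<theta>h * Y t + \<theta>h / \<alpha> * Z t"
                  using mult_left_mono[OF err, of \<theta>h] \<theta>h by (simp add: algebra_simps)
                also have "\<dots> \<le> m * Y t + m * Z t"
                  using m nonneg by (intro add_mono mult_right_mono) auto
                finally show ?thesis by (simp add: algebra_simps)
              qed
              have "norm (g t) \<le> \<theta> * X t + m * (Y t + Z t)"
                using estimates(1)[of "x t" "s t"] err' unfolding g_def X_def e_def by linarith
              also have "\<dots> \<le> m * X t + m * (Y t + Z t)"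
                using m nonneg by (intro add_mono mult_right_mono) auto
              finally have g_le: "norm (g t) \<le> m * (X t + Y t + Z t)"
                by (simp add: algebra_simps)
              have "norm (D (- \<delta> *\<^sub>R g t)) \<le> onorm D * norm (- \<delta> *\<^sub>R g t)"
                by (rule onorm[OF has_derivative_bounded_linear[OF D]])
              also have "\<dots> \<le> l * norm (- \<delta> *\<^sub>R g t)"
                using onorm_le unfolding D_def by (intro mult_right_mono) auto
              also have "\<dots> = l * (\<delta> * norm (g t))"
                using \<delta> by simp
              also have "\<dots> \<le> l * (\<delta> * (m * (X t + Y t + Z t)))"
                using g_le l \<delta> by (intro mult_left_mono) auto
              finally have D_le: "norm (D (- \<delta> *\<^sub>R g t)) \<le> l * (\<delta> * (m * (X t + Y t + Z t)))" .
              have "- (w t \<bullet> D (- \<delta> *\<^sub>R g t)) \<le> Z t * norm (D (- \<delta> *\<^sub>R g t))"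
                using Cauchy_Schwarz_ineq2[of "w t" "D (- \<delta> *\<^sub>R g t)"] by (simp add: Z_def)
              also have "\<dots> \<le> Z t * (l * (\<delta> * (m * (X t + Y t + Z t))))"
                using D_le nonneg by (intro mult_left_mono)
              finally have "\<alpha> * - (w t \<bullet> D (- \<delta> *\<^sub>R g t)) \<le> \<alpha> * (Z t * (l * (\<delta> * (m * (X t + Y t + Z t)))))"
                using \<alpha> by (intro mult_left_mono) auto
              also have "\<dots> = (\<alpha> * l * m) * (\<delta> * Z t * (X t + Y t + Z t))"
                by (simp add: mult_ac)
              also have "\<dots> \<le> b * (\<delta> * Z t * (X t + Y t + Z t))"
                using b \<delta> nonneg by (intro mult_right_mono) auto
              finally have "\<alpha> * - (w t \<bullet> D (- \<delta> *\<^sub>R g t)) \<le> b * (\<delta> * Z t * (X t + Y t + Z t))" .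
              moreover have "p1 = - \<alpha> * (Z t)\<^sup>2 + \<alpha> * - (w t \<bullet> D (- \<delta> *\<^sub>R g t))"
                unfolding p1_def Z_def inner_diff_right inner_scaleR_right power2_norm_eq_inner by simp
              ultimately show "p1 \<le> - \<alpha> * (Z t)\<^sup>2 + \<delta> * b * Z t * (X t + Y t + Z t)"
                by (simp add: mult_ac)
              have "- (e t \<bullet> g t) \<le> - \<mu> * (X t)\<^sup>2 + X t * (\<theta>h * norm (s t - P_avg (stack \<phi> (x t))))"
                using estimates(2)[of "x t" "s t"] unfolding g_def X_def e_def by (simp add: mult_ac)
              also have "\<dots> \<le> - \<mu> * (X t)\<^sup>2 + X t * (b * (Y t + Z t))"
              proof -
                have "m * (Y t + Z t) \<le> b * (Y t + Z t)"
                  using b nonneg by (intro mult_right_mono) auto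
                then show ?thesis
                  using err' nonneg by (intro add_left_mono mult_left_mono) auto
              qed
              finally have "\<delta> * - (e t \<bullet> g t) \<le> \<delta> * (- \<mu> * (X t)\<^sup>2 + X t * (b * (Y t + Z t)))"
                using \<delta> by (intro mult_left_mono) auto
              moreover have "p2 = \<delta> * - (e t \<bullet> g t)"
                by (simp add: p2_def)
              moreover have "\<delta> * (- \<mu> * (X t)\<^sup>2 + X t * (b * (Y t + Z t)))
                  = - \<delta> * \<mu> * (X t)\<^sup>2 + \<delta> * b * X t * (Y t + Z t)"
                by (simp add: algebra_simps)
              ultimately show "p2 \<le> - \<delta> * \<mu> * (X t)\<^sup>2 + \<delta> * b * X t * (Y t + Z t)"
                by linarith
            qed (rule nonneg U'(2))+
            ultimately show "\<exists>W'. (W has_real_derivative W') (at t) \<and> W' \<le> - r * W t"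
              by (auto simp: W_def X_def Z_def)
          qed
          define C where "C = sqrt (W 0)"
          define h where "h = (\<lambda>t. exp (- (r / 2) * t))"
          have W_ge: "(Y t)\<^sup>2 + k * (Z t)\<^sup>2 + (X t)\<^sup>2 \<le> W t" if "t \<ge> 0" for t
            using U_bounds[OF that, of "s t"] by (simp add: W_def X_def Y_def Z_def)
          have "0 \<le> W 0"
            using k by (intro order_trans[OF _ W_ge] add_nonneg_nonneg) auto
          then have C: "C \<ge> 0" by (simp add: C_def)
          have root: "u \<le> C * h t" if "t \<ge> 0" "u\<^sup>2 \<le> W t" for t u
          proof (rule power2_le_imp_le)
            have "(h t)\<^sup>2 = exp (- r * t)"
              unfolding h_def power2_eq_square exp_add[symmetric] by (simp add: algebra_simps)
            moreover have "C\<^sup>2 = W 0"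
              using \<open>0 \<le> W 0\<close> by (simp add: C_def)
            ultimately show "u\<^sup>2 \<le> (C * h t)\<^sup>2"
              using that W_decay[of t] by (simp add: power_mult_distrib)
            show "0 \<le> C * h t" using C by (simp add: h_def)
          qed
          have X_le: "X t \<le> C * h t" and Y_le: "Y t \<le> C * h t" and kZ_le: "sqrt k * Z t \<le> C * h t"
            if "t \<ge> 0" for t
          proof -
            have kZ: "(sqrt k * Z t)\<^sup>2 = k * (Z t)\<^sup>2"
              using k by (simp add: power_mult_distrib)
            have "0 \<le> k * (Z t)\<^sup>2" using k by simp
            then show "X t \<le> C * h t" "Y t \<le> C * h t" "sqrt k * Z t \<le> C * h t"
              using W_ge[OF that] kZ zero_le_power2[of "X t"] zero_le_power2[of "Y t"]
              by (intro root[OF that]; linarith)+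
          qed
          \<comment> \<open>One constant for all three errors.\<close>
          define C' where "C' = C + C / sqrt k"
          have C': "C' \<ge> 0" "C \<le> C'" "C / sqrt k \<le> C'"
            using C k by (auto simp: C'_def)
          have enlarge: "u \<le> C' * h t" if "u \<le> B * h t" "B \<le> C'" for u B t
          proof -
            have "B * h t \<le> C' * h t"
              using that(2) by (rule mult_right_mono) (simp add: h_def)
            with that(1) show ?thesis by linarith
          qed
          show ?case
          proof (rule convergence_from_error_decay[OF \<alpha> half_gt_zero[OF r] less_imp_le[OF l] C'(1)])
            show "norm (stack \<phi> y - stack \<phi> z) \<le> l * norm (y - z)" for y z
              by (rule stack_lipschitz[OF phi_C1 onorm_le])
            show "P_avg (\<nu> t) = 0" if "t \<ge> 0" for t
              by (rule avg_\<nu>[OF that])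
            fix t :: real assume t: "t \<ge> 0"
            show "norm (x t - xs) \<le> C' * exp (- (r / 2) * t)"
              using enlarge[OF X_le[OF t] C'(2)] by (simp add: X_def e_def h_def)
            show "norm (P_perp (s t)) \<le> C' * exp (- (r / 2) * t)"
              using enlarge[OF Y_le[OF t] C'(2)] by (simp add: Y_def h_def)
            have "Z t \<le> C / sqrt k * h t"
              using kZ_le[OF t] k by (simp add: field_simps)
            then show "norm (fast_error \<phi> \<alpha> (x t) (s t) (\<nu> t)) \<le> C' * exp (- (r / 2) * t)"
              using enlarge[OF _ C'(3)] by (simp add: Z_def w_def h_def)
          qed
        qed
      qed
    qed
  qed
  show ?thesis
    using unique main by blast
qed

end
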